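(* Let $0\le\beta<1$ and let $p\in\mathbf{N}_0$ be fixed. Then there exists a positive constant $M_5(b_1,p,\beta)$, depending only on $b_1,p,\beta$, such that for every $f\in C_p$, all $x>0$ and all $n\in\mathbf{N}$, $$\omega_p(x)\left|J_n^{[\beta]}(f;a_n,b_n;x)-f(x)\right|\le \left|\frac{a_n}{b_n(1-\beta)}-1\right|x\,\bigl(\xi_{n,\beta}(x)\bigr)^{-1/2}\,\omega_1\!\left(f,C_p,\sqrt{\xi_{n,\beta}(x)}\right)+M_5(b_1,p,\beta)\,\omega_2\!\left(f,C_p,\sqrt{\xi_{n,\beta}(x)}\right).$$ For $x=0$ one has $J_n^{[\beta]}(f;a_n,b_n;0)=f(0)$.
   Context: $\mathbf{R}_0=[0,\infty)$, $\mathbf{N}=\{1,2,\dots\}$, $\mathbf{N}_0=\mathbf{N}\cup\{0\}$. Throughout, $(a_n)_{n\ge1}$ and $(b_n)_{n\ge1}$ are given increasing unbounded real sequences with $a_n\ge1$, $b_n\ge1$, such that $(a_n/b_n)_{n\ge1}$ is non-decreasing and $a_n/b_n=1+o(1/b_n)$ as $n\to\infty$. For $0\le\beta<1$, $\alpha\in\mathbf{R}_0$, $k\in\mathbf{N}_0$ put $$\omega_\beta(k,\alpha)=\frac{\alpha}{k!}(\alpha+k\beta)^{k-1}e^{-(\alpha+k\beta)},$$ with $\omega_\beta(0,\alpha)=e^{-\alpha}$ (in particular $\omega_\beta(0,0)=1$) and $\omega_\beta(k,0)=0$ for $k\ge1$. The operators are $$J_n^{[\beta]}(f;a_n,b_n;x)=\sum_{k=0}^\infty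 \omega_\beta(k,a_nx)\,f\!\left(\frac{k}{b_n}\right),\qquad x\in\mathbf{R}_0,\ n\in\mathbf{N}.$$ Weights: $\omega_0(x)=1$ and $\omega_p(x)=(1+x^p)^{-1}$ for $p\ge1$, $x\in\mathbf{R}_0$. $B_p$ is the set of all $f:\mathbf{R}_0\to\mathbf{R}$ with $f\omega_p$ bounded on $\mathbf{R}_0$, normed by $\|f\|_p=\sup_{x\in\mathbf{R}_0}\omega_p(x)|f(x)|$. $C_p$ is the set of all $f\in B_p$ for which $f\omega_p$ is uniformly continuous on $\mathbf{R}_0$. For $f\in C_p$ and $t\ge0$, the modulus of continuity and the modulus of smoothness (not to be confused with the weights $\omega_p(x)$) are $$\omega_1(f,C_p,t)=\sup_{0\le h\le t}\|\Delta_hf\|_p,\qquad \omega_2(f,C_p,t)=\sup_{0\le h\le t}\|\Delta_h^2f\|_p,$$ where $\Delta_hf(x)=f(x+h)-f(x)$ and $\Delta_h^2f(x)=f(x)-2f(x+h)+f(x+2h)$. Finally, $$\xi_{n,\beta}(x)=x^2\left(\frac{a_n}{b_n(1-\beta)}-1\right)^2+\frac{x}{b_n(1-\beta)^3},\qquad x\in\mathbf{R}_0,\ n\in\mathbf{N}.$$ *)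

theory Defs
  imports "HOL-Analysis.Analysis" "HOL-Library.Landau_Symbols"
begin

text \<open>
  Functions on \<open>[0, \<infinity>)\<close> are represented by functions of type \<^typ>\<open>real \<Rightarrow> real\<close>, of which only
  the values at non-negative arguments are ever used. Sequences are indexed from 1; the
  entry at index 0 is irrelevant.
\<close>

definition admissible :: "(nat \<Rightarrow> real) \<Rightarrow> (nat \<Rightarrow> real) \<Rightarrow> bool" where
  "admissible a b \<longleftrightarrow>
     strict_mono_on {1..} a \<and> \<not> bdd_above (a ` {1..}) \<and> (\<forall>n\<ge>1. a n \<ge> 1) \<and>
     strict_mono_on {1..} b \<and> \<not> bdd_above (b ` {1..}) \<and> (\<forall>n\<ge>1. b n \<ge> 1) \<and>
     mono_on {1..} (\<lambda>n. a n / b n) \<and>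
     (\<lambda>n. a n / b n - 1) \<in> o(\<lambda>n. 1 / b n)"

text \<open>For \<open>k = 0\<close> the exponent \<open>k - 1\<close> is \<open>-1\<close>, so the formula reduces to \<open>exp (- \<alpha>)\<close>, also
  (by convention) for \<open>\<alpha> = 0\<close>.\<close>

definition jain_prob :: "real \<Rightarrow> nat \<Rightarrow> real \<Rightarrow> real" where
  "jain_prob \<beta> k \<alpha> =
     (if k = 0 then exp (- \<alpha>)
      else \<alpha> / fact k * (\<alpha> + real k * \<beta>) ^ (k - 1) * exp (- (\<alpha> + real k * \<beta>)))"

definition jain_op ::
    "real \<Rightarrow> (nat \<Rightarrow> real) \<Rightarrow> (nat \<Rightarrow> real) \<Rightarrow> nat \<Rightarrow> (real \<Rightarrow> real) \<Rightarrow> real \<Rightarrow> real" where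
  "jain_op \<beta> a b n f x = (\<Sum>k. jain_prob \<beta> k (a n * x) * f (real k / b n))"

definition weight :: "nat \<Rightarrow> real \<Rightarrow> real" where
  "weight p x = (if p = 0 then 1 else inverse (1 + x ^ p))"

definition B_space :: "nat \<Rightarrow> (real \<Rightarrow> real) set" where
  "B_space p = {f. bounded ((\<lambda>x. f x * weight p x) ` {0..})}"

definition C_space :: "nat \<Rightarrow> (real \<Rightarrow> real) set" where
  "C_space p = {f \<in> B_space p. uniformly_continuous_on {0..} (\<lambda>x. f x * weight p x)}"

definition wnorm :: "nat \<Rightarrow> (real \<Rightarrow> real) \<Rightarrow> real" where
  "wnorm p f = (SUP x\<in>{0..}. weight p x * \<bar>f x\<bar>)"

definition diff1 :: "real \<Rightarrow> (real \<Rightarrow> real) \<Rightarrow> real \<Rightarrow> real" where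
  "diff1 h f x = f (x + h) - f x"

definition diff2 :: "real \<Rightarrow> (real \<Rightarrow> real) \<Rightarrow> real \<Rightarrow> real" where
  "diff2 h f x = f x - 2 * f (x + h) + f (x + 2 * h)"

text \<open>For \<open>f \<in> C_space p\<close> and \<open>t \<ge> 0\<close>, the suprema in the two moduli below (and those inside
  \<^const>\<open>wnorm\<close>) range over non-empty bounded sets of reals, so they are genuine suprema.\<close>

definition modulus1 :: "nat \<Rightarrow> (real \<Rightarrow> real) \<Rightarrow> real \<Rightarrow> real" where
  "modulus1 p f t = (SUP h\<in>{0..t}. wnorm p (diff1 h f))"

definition modulus2 :: "nat \<Rightarrow> (real \<Rightarrow> real) \<Rightarrow> real \<Rightarrow> real" where
  "modulus2 p f t = (SUP h\<in>{0..t}. wnorm p (diff2 h f))"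

definition xi :: "real \<Rightarrow> (nat \<Rightarrow> real) \<Rightarrow> (nat \<Rightarrow> real) \<Rightarrow> nat \<Rightarrow> real \<Rightarrow> real" where
  "xi \<beta> a b n x = x\<^sup>2 * (a n / (b n * (1 - \<beta>)) - 1)\<^sup>2 + x / (b n * (1 - \<beta>) ^ 3)"

end

theory Submission
  imports Defs
begin

text \<open>
  Write \<open>\<alpha> = a n * x\<close>, let \<open>Y = k / b n\<close> be the random point at which the operator samples \<open>f\<close> (with
  \<open>k\<close> distributed by \<^const>\<open>jain_prob\<close>), let \<open>z = \<alpha> / (b n * (1 - \<beta>))\<close> be the mean of \<open>Y\<close>, and let
  \<open>t = sqrt (xi \<beta> a b n x)\<close>. The error is split as
  \<open>(E f(Y) - f z) + (f z - f x)\<close>, where \<open>E\<close> is the expectation.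

  Both parts are compared with a secant: let \<open>L\<close> be the affine function that agrees with \<open>f\<close> at \<open>v\<close>
  and \<open>v + t\<close>. If all second differences of \<open>f\<close> with step at most \<open>t\<close> are at most \<open>S\<close>, then
  \<open>\<bar>f y - L y\<bar> \<le> S\<close> between the two nodes (at a maximum of \<open>\<bar>f - L\<bar>\<close> the second difference
  centred there and reaching the nearer node already bounds it), and
  \<open>\<bar>f y - L y\<bar> \<le> 8 * (1 + ((y - v) / t)\<^sup>2) * S\<close> everywhere (\<open>secant_error\<close>), since a sequence with
  bounded second differences grows at most quadratically.

  For \<open>f z - f x\<close>, the nodes start at \<open>min x z\<close>. As \<open>\<bar>z - x\<bar> \<le> t\<close>, the secant contributes
  \<open>\<bar>z - x\<bar> / t\<close> times a first difference of step \<open>t\<close>. This is what gives the factor in front of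
  the first modulus without an additional constant, and the rest is bounded by the second modulus
  (\<open>weighted_shift_le\<close>).

  For \<open>E f(Y) - f z\<close>, the nodes start at \<open>z\<close>. Then \<open>E L(Y) = L z = f z\<close>, so that only
  \<open>E (1 + ((Y - z) / t)\<^sup>2) * S(Y)\<close> remains, where the weights make \<open>S(Y)\<close> a multiple of the second
  modulus growing like \<open>1 + Y ^ p\<close> (\<open>jain_series_error\<close>). This needs the bound
  \<open>E (k - \<mu>)\<^sup>2 * k ^ p \<le> C * \<alpha> * (1 + \<alpha>) ^ p\<close> with \<open>\<mu> = \<alpha> / (1 - \<beta>)\<close> (\<open>jain_central_moment_le\<close>): one
  power of \<open>\<alpha>\<close> less than the size of the integrand suggests, so a cancellation must be used.

  The moments come from Abel's binomial identity. In probabilistic terms it says that \<open>k\<close> is a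
  compound Poisson variable, and it yields the recursion
  \<open>E k ^ (r + 1) = \<alpha> * (\<Sum>m. jain_tilt \<beta> m \<beta> * E (k + m + 1) ^ r)\<close> (\<open>jain_moment_Suc\<close>). The same
  identity also shows that the weights \<^const>\<open>jain_prob\<close> have total mass one for every \<open>\<beta> < 1\<close>
  (\<open>suminf_jain_prob\<close>): the total mass is multiplicative in \<open>\<alpha>\<close>, hence an exponential, and its rate
  is forced to be zero.
\<close>

section \<open>Abel's identity and geometric decay\<close>

text \<open>
  Up to the factor \<open>1 - \<beta>\<close> this is again a probability distribution (\<open>suminf_jain_tilt\<close> below); it is
  the distribution with the weights \<open>jain_prob \<beta> k \<alpha>\<close> biased by the factor \<open>(\<alpha> + k * \<beta>) / \<alpha>\<close>.
\<close>

definition jain_tilt :: "real \<Rightarrow> nat \<Rightarrow> real \<Rightarrow> real" where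
  "jain_tilt \<beta> k \<alpha> = (\<alpha> + real k * \<beta>) ^ k / fact k * exp (- (\<alpha> + real k * \<beta>))"

text \<open>
  Abel's identity. With \<open>A k x\<close> and \<open>B k x\<close> as in the proof, both families satisfy
  \<open>F (Suc k)' x = F k (x + \<beta>)\<close>. Differentiating the identity for \<open>Suc n\<close> in \<open>x\<close> therefore gives the
  identity for \<open>n\<close> at \<open>x + \<beta>\<close>, and at \<open>x = 0\<close> only the term \<open>k = 0\<close> survives.
\<close>

lemma abel_binomial:
  fixes \<beta> x y :: real
  shows "(x + y + real n * \<beta>) ^ n / fact n =
    (\<Sum>k\<le>n. (if k = 0 then 1 else x * (x + real k * \<beta>) ^ (k - 1) / fact k) *
             ((y + real (n - k) * \<beta>) ^ (n - k) / fact (n - k)))"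
proof (induction n arbitrary: x)
  case 0
  show ?case by simp
next
  case (Suc n)
  define A where "A = (\<lambda>k x. if k = 0 then 1 else x * (x + real k * \<beta>) ^ (k - 1) / fact k)"
  define B where "B = (\<lambda>k x. (x + real k * \<beta>) ^ k / fact k)"
  have dB: "(B (Suc k) has_real_derivative B k (u + \<beta>)) (at u)" for k u
  proof -
    have "((\<lambda>x. (x + real (Suc k) * \<beta>) ^ Suc k) has_real_derivative
            real (Suc k) * (u + real (Suc k) * \<beta>) ^ k) (at u)"
      by (rule derivative_eq_intros refl | simp)+
    from DERIV_cdivide[OF this, of "fact (Suc k)"] show ?thesis
      unfolding B_def by (simp add: algebra_simps del: of_nat_Suc) (simp add: field_simps)
  qed
  have dA: "(A (Suc k) has_real_derivative A k (u + \<beta>)) (at u)" for k u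
  proof (cases k)
    case 0
    then show ?thesis unfolding A_def by (auto intro!: derivative_eq_intros)
  next
    case (Suc j)
    define c where "c = real (Suc (Suc j)) * \<beta>"
    have "((\<lambda>x. x * (x + c) ^ Suc j) has_real_derivative
            (u + c) ^ Suc j + u * (real (Suc j) * (u + c) ^ j)) (at u)"
      by (rule derivative_eq_intros refl | simp)+
    moreover have "(u + c) ^ Suc j + u * (real (Suc j) * (u + c) ^ j) =
        real (Suc (Suc j)) * ((u + \<beta>) * (u + c) ^ j)"
      by (simp add: c_def algebra_simps)
    ultimately have "((\<lambda>x. x * (x + c) ^ Suc j) has_real_derivative
            real (Suc (Suc j)) * ((u + \<beta>) * (u + c) ^ j)) (at u)" by simp
    from DERIV_cdivide[OF this, of "fact (Suc (Suc j))"]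
    have "((\<lambda>x. x * (x + c) ^ Suc j / fact (Suc (Suc j))) has_real_derivative
            (u + \<beta>) * (u + c) ^ j / fact (Suc j)) (at u)"
      by (subst (asm) (2) fact_Suc) (simp del: of_nat_Suc fact_Suc)
    moreover have "u + c = u + \<beta> + real (Suc j) * \<beta>" by (simp add: c_def algebra_simps)
    ultimately show ?thesis unfolding A_def Suc c_def by (simp del: of_nat_Suc fact_Suc)
  qed
  let ?F = "\<lambda>x. (\<Sum>k\<le>Suc n. A k x * B (Suc n - k) y) - B (Suc n) (x + y)"
  have split: "(\<Sum>k\<le>Suc n. A k x * B (Suc n - k) y) =
      B (Suc n) y + (\<Sum>k\<le>n. A (Suc k) x * B (n - k) y)" for x
    by (subst sum.atMost_Suc_shift) (simp add: A_def)
  have "(?F has_real_derivative 0) (at u)" for u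
  proof -
    have dS: "((\<lambda>x. \<Sum>k\<le>n. A (Suc k) x * B (n - k) y) has_real_derivative
            (\<Sum>k\<le>n. A k (u + \<beta>) * B (n - k) y)) (at u)"
      by (intro DERIV_sum DERIV_cmult_right dA)
    have IH: "(\<Sum>k\<le>n. A k (u + \<beta>) * B (n - k) y) = B n (u + y + \<beta>)"
      using Suc.IH[of "u + \<beta>"] unfolding A_def B_def by (simp add: algebra_simps)
    have "((\<lambda>x. B (Suc n) (x + y)) has_real_derivative B n (u + y + \<beta>)) (at u)"
      using DERIV_shift[THEN iffD1, OF dB] .
    from DERIV_diff[OF DERIV_add[OF DERIV_const dS] this] show ?thesis
      unfolding split IH by simp
  qed
  then have "?F x = ?F 0" by (intro DERIV_isconst_all allI)
  moreover have "?F 0 = 0" unfolding split by (simp add: A_def)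
  ultimately have "B (Suc n) (x + y) = (\<Sum>k\<le>Suc n. A k x * B (Suc n - k) y)" by simp
  then show ?case unfolding A_def B_def .
qed

lemma jain_prob_nonneg: "0 \<le> \<beta> \<Longrightarrow> 0 \<le> \<alpha> \<Longrightarrow> 0 \<le> jain_prob \<beta> k \<alpha>"
  by (simp add: jain_prob_def)

lemma jain_tilt_nonneg: "0 \<le> \<beta> \<Longrightarrow> 0 \<le> \<alpha> \<Longrightarrow> 0 \<le> jain_tilt \<beta> k \<alpha>"
  by (simp add: jain_tilt_def)

lemma jain_tilt_convolution:
  "jain_tilt \<beta> n (x + y) = (\<Sum>k\<le>n. jain_prob \<beta> k x * jain_tilt \<beta> (n - k) y)"
proof -
  have e: "exp (- (x + y + real n * \<beta>)) = exp (- (x + real k * \<beta>)) * exp (- (y + real (n - k) * \<beta>))"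
    if "k \<le> n" for k
    using that by (simp add: mult_exp_exp of_nat_diff algebra_simps)
  show ?thesis
    unfolding jain_tilt_def abel_binomial sum_distrib_right
  proof (intro sum.cong refl, goal_cases)
    case (1 k)
    then have "k \<le> n" by simp
    show ?case unfolding e[OF \<open>k \<le> n\<close>] by (simp add: jain_prob_def)
  qed
qed

lemma jain_prob_at_0: "jain_prob \<beta> k 0 = (if k = 0 then 1 else 0)"
  by (simp add: jain_prob_def)

lemma jain_prob_le_tilt:
  assumes "0 \<le> \<beta>" "0 \<le> \<alpha>"
  shows "jain_prob \<beta> k \<alpha> \<le> jain_tilt \<beta> k \<alpha>"
proof (cases k)
  case (Suc j)
  have "\<alpha> * (\<alpha> + real k * \<beta>) ^ j \<le> (\<alpha> + real k * \<beta>) * (\<alpha> + real k * \<beta>) ^ j"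
    using assms by (intro mult_right_mono) auto
  then show ?thesis
    using Suc by (auto simp: jain_prob_def jain_tilt_def intro!: mult_right_mono divide_right_mono)
qed (simp add: jain_prob_def jain_tilt_def)

lemma jain_tilt_0: "jain_tilt \<beta> 0 \<alpha> = jain_prob \<beta> 0 \<alpha>"
  by (simp add: jain_tilt_def jain_prob_def)

lemma jain_tilt_Suc:
  "jain_tilt \<beta> (Suc k) \<alpha> = jain_prob \<beta> (Suc k) \<alpha> + \<beta> * jain_tilt \<beta> k (\<alpha> + \<beta>)"
proof -
  define y where "y = \<alpha> + real (Suc k) * \<beta>"
  have "\<alpha> + \<beta> + real k * \<beta> = y" by (simp add: y_def algebra_simps)
  moreover have "y ^ Suc k / fact (Suc k) = \<alpha> / fact (Suc k) * y ^ k + \<beta> * (y ^ k / fact k)"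
    by (simp add: divide_simps) (simp add: y_def algebra_simps)
  ultimately show ?thesis
    unfolding jain_tilt_def jain_prob_def y_def[symmetric] by (simp add: algebra_simps)
qed

text \<open>
  Multiplying by \<open>k\<close> lowers \<open>k\<close> and moves \<open>\<alpha>\<close> to \<open>\<alpha> + \<beta>\<close>. Together with the convolution
  identity this is the source of the moment recursion.
\<close>

lemma jain_prob_size_bias:
  "real (Suc k) * jain_prob \<beta> (Suc k) \<alpha> = \<alpha> * jain_tilt \<beta> k (\<alpha> + \<beta>)"
proof -
  have "\<alpha> + \<beta> + real k * \<beta> = \<alpha> + real (Suc k) * \<beta>" by (simp add: algebra_simps)
  then show ?thesis
    unfolding jain_tilt_def jain_prob_def by (simp only:) (simp del: of_nat_Suc)
qed

lemma power_over_fact_le_exp: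
  fixes y :: real
  assumes "0 \<le> y"
  shows "y ^ k / fact k \<le> exp y"
proof -
  have "(\<lambda>n. y ^ n /\<^sub>R fact n) k \<le> (\<Sum>n. y ^ n /\<^sub>R fact n)"
    using assms by (intro sum_le_suminf[of _ "{k}", simplified] summable_exp_generic) auto
  then show ?thesis by (simp add: exp_def field_simps)
qed

text \<open>
  For \<open>y = \<alpha> + k * \<beta>\<close> and any \<open>s > 0\<close>, the exponential series gives
  \<open>y ^ k / fact k \<le> exp ((1 + s) * y) / (1 + s) ^ k\<close>, so the terms decay like the powers of
  \<open>exp (s * \<beta>) / (1 + s)\<close>. Because \<open>\<beta> < 1\<close>, this ratio is below one for small \<open>s\<close>.
\<close>

lemma jain_tilt_geometric_bound:
  assumes "0 \<le> \<beta>" "\<beta> < 1"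
  shows "\<exists>s \<rho>. 0 < \<rho> \<and> \<rho> < 1 \<and>
    (\<forall>k \<alpha>. 0 \<le> \<alpha> \<longrightarrow> jain_tilt \<beta> k \<alpha> \<le> exp (s * \<alpha>) * \<rho> ^ k)"
proof -
  \<comment> \<open>With this choice \<open>(1 + s) * (1 - s * \<beta>) = 1 + s\<^sup>3\<close>, while \<open>exp (s * \<beta>) \<le> 1 / (1 - s * \<beta>)\<close>.\<close>
  define s where "s = 1 - \<beta>"
  define \<rho> where "\<rho> = exp (s * \<beta>) / (1 + s)"
  have s: "s > 0" "s \<le> 1" using assms by (auto simp: s_def)
  have "s * \<beta> < 1" using s assms by (smt (verit) mult_left_le_one_le)
  have "exp (s * \<beta>) * (1 - s * \<beta>) \<le> exp (s * \<beta>) * exp (- (s * \<beta>))"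
    using exp_ge_add_one_self[of "- (s * \<beta>)"] by (intro mult_left_mono) auto
  also have "\<dots> = 1" by (simp add: exp_minus)
  also have "1 < (1 + s) * (1 - s * \<beta>)"
  proof -
    have "(1 + s) * (1 - s * \<beta>) = 1 + s * (s - s * \<beta>)" by (simp add: s_def algebra_simps)
    moreover have "s - s * \<beta> = s * s" by (simp add: s_def algebra_simps)
    ultimately show ?thesis using s by simp
  qed
  finally have "exp (s * \<beta>) < 1 + s"
    using \<open>s * \<beta> < 1\<close> by (simp add: mult_less_cancel_right)
  then have r: "0 < \<rho>" "\<rho> < 1" using s by (auto simp: \<rho>_def)
  have "jain_tilt \<beta> k \<alpha> \<le> exp (s * \<alpha>) * \<rho> ^ k" if "0 \<le> \<alpha>" for k \<alpha>
  proof -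
    define y where "y = \<alpha> + real k * \<beta>"
    have y: "0 \<le> y" using that assms by (simp add: y_def)
    have "((1 + s) * y) ^ k / fact k \<le> exp ((1 + s) * y)"
      using y s by (intro power_over_fact_le_exp) simp
    then have "y ^ k / fact k \<le> exp ((1 + s) * y) / (1 + s) ^ k"
      using s unfolding power_mult_distrib by (simp add: divide_simps) (simp add: mult_ac)
    then have "jain_tilt \<beta> k \<alpha> \<le> exp ((1 + s) * y) / (1 + s) ^ k * exp (- y)"
      unfolding jain_tilt_def y_def[symmetric] by (intro mult_right_mono) auto
    also have "\<dots> = exp (s * \<alpha>) * \<rho> ^ k"
      by (simp add: \<rho>_def power_divide y_def exp_of_nat_mult[symmetric] mult_exp_exp algebra_simps)
    finally show ?thesis .
  qed
  with r show ?thesis by (intro exI[of _ s] exI[of _ \<rho>]) simp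
qed

text \<open>
  Each further factor \<open>k\<close> is produced by differentiating a power series termwise, which does not
  change its radius of convergence.
\<close>

lemma summable_power_mult_geometric:
  fixes \<rho> :: real
  assumes "0 < \<rho>" "\<rho> < 1"
  shows "summable (\<lambda>k. real k ^ r * \<rho> ^ k)"
proof -
  have "summable (\<lambda>k. real k ^ r * x ^ k)" if "norm x < 1" for x :: real
    using that
  proof (induction r arbitrary: x)
    case 0
    then show ?case by (simp add: summable_geometric)
  next
    case (Suc r)
    have "summable (\<lambda>k. diffs (\<lambda>k. real k ^ r) k * x ^ k)"
      by (rule termdiff_converges[OF Suc.prems Suc.IH])
    then have "summable (\<lambda>k. diffs (\<lambda>k. real k ^ r) k * x ^ k * x)"
      by (rule summable_mult2)
    then have "summable (\<lambda>k. real (Suc k) ^ Suc r * x ^ Suc k)"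
      by (simp add: diffs_def mult_ac)
    then show ?case by (subst (asm) summable_Suc_iff)
  qed
  then show ?thesis using assms by simp
qed

section \<open>Total mass\<close>

lemma summable_power_mult_jain_tilt:
  assumes "0 \<le> \<beta>" "\<beta> < 1" "0 \<le> \<alpha>"
  shows "summable (\<lambda>k. real k ^ r * jain_tilt \<beta> k \<alpha>)"
proof -
  obtain s \<rho> where \<rho>: "0 < \<rho>" "\<rho> < 1"
    and b: "\<And>k \<alpha>. 0 \<le> \<alpha> \<Longrightarrow> jain_tilt \<beta> k \<alpha> \<le> exp (s * \<alpha>) * \<rho> ^ k"
    using jain_tilt_geometric_bound[OF assms(1,2)] by metis
  have "summable (\<lambda>k. exp (s * \<alpha>) * (real k ^ r * \<rho> ^ k))"
    by (intro summable_mult summable_power_mult_geometric \<rho>)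
  then show ?thesis
  proof (rule summable_comparison_test')
    fix k :: nat
    have "real k ^ r * jain_tilt \<beta> k \<alpha> \<le> real k ^ r * (exp (s * \<alpha>) * \<rho> ^ k)"
      using b[OF assms(3)] by (intro mult_left_mono) auto
    then show "norm (real k ^ r * jain_tilt \<beta> k \<alpha>) \<le> exp (s * \<alpha>) * (real k ^ r * \<rho> ^ k)"
      using jain_tilt_nonneg[OF assms(1,3)] by (simp add: mult_ac)
  qed
qed

lemma summable_power_mult_jain_prob:
  assumes "0 \<le> \<beta>" "\<beta> < 1" "0 \<le> \<alpha>"
  shows "summable (\<lambda>k. real k ^ r * jain_prob \<beta> k \<alpha>)"
  by (rule summable_comparison_test'[OF summable_power_mult_jain_tilt[OF assms]])
    (use assms in \<open>auto simp: jain_prob_nonneg intro!: mult_left_mono jain_prob_le_tilt\<close>)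

lemmas summable_jain_tilt = summable_power_mult_jain_tilt[where r = 0, simplified]
lemmas summable_jain_prob = summable_power_mult_jain_prob[where r = 0, simplified]

lemma summable_jain_prob_Suc:
  assumes "0 \<le> \<beta>" "\<beta> < 1" "0 \<le> \<alpha>"
  shows "summable (\<lambda>k. jain_prob \<beta> (Suc k) \<alpha>)"
  using summable_jain_prob[OF assms] by (rule summable_ignore_initial_segment[where k = 1, simplified])

lemma suminf_jain_tilt_add:
  assumes "0 \<le> \<beta>" "\<beta> < 1" "0 \<le> x" "0 \<le> y"
  shows "(\<Sum>k. jain_tilt \<beta> k (x + y)) = (\<Sum>k. jain_prob \<beta> k x) * (\<Sum>k. jain_tilt \<beta> k y)"
  unfolding jain_tilt_convolution
  by (rule Cauchy_product[symmetric])
    (use assms in \<open>auto simp: jain_prob_nonneg jain_tilt_nonneg summable_jain_prob summable_jain_tilt\<close>)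

lemma suminf_jain_tilt_shift:
  assumes "0 \<le> \<beta>" "\<beta> < 1" "0 \<le> \<alpha>"
  shows "(\<Sum>k. jain_tilt \<beta> k \<alpha>) =
    (\<Sum>k. jain_prob \<beta> k \<alpha>) + \<beta> * (\<Sum>k. jain_tilt \<beta> k (\<alpha> + \<beta>))"
proof -
  have sm: "summable (\<lambda>k. jain_prob \<beta> (Suc k) \<alpha>)" "summable (\<lambda>k. jain_tilt \<beta> k (\<alpha> + \<beta>))"
    using assms by (simp_all add: summable_jain_prob_Suc summable_jain_tilt)
  have "(\<Sum>k. jain_tilt \<beta> k \<alpha>) = (\<Sum>k. jain_tilt \<beta> (Suc k) \<alpha>) + jain_prob \<beta> 0 \<alpha>"
    using suminf_split_head[OF summable_jain_tilt[OF assms]] by (simp add: jain_tilt_0)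
  also have "(\<Sum>k. jain_tilt \<beta> (Suc k) \<alpha>) =
      (\<Sum>k. jain_prob \<beta> (Suc k) \<alpha>) + \<beta> * (\<Sum>k. jain_tilt \<beta> k (\<alpha> + \<beta>))"
    unfolding jain_tilt_Suc using sm
    by (subst suminf_add[symmetric]) (auto simp: suminf_mult intro!: summable_mult)
  also have "(\<Sum>k. jain_prob \<beta> (Suc k) \<alpha>) = (\<Sum>k. jain_prob \<beta> k \<alpha>) - jain_prob \<beta> 0 \<alpha>"
    using suminf_split_head[OF summable_jain_prob[OF assms]] by simp
  finally show ?thesis by simp
qed

text \<open>
  This bound and the next one sandwich the total mass for small \<open>h\<close> between
  \<open>exp (- h) * (1 + h * \<nu>)\<close> and \<open>exp (- h) / (1 - h * \<nu>)\<close>, where \<open>\<nu>\<close> is the total mass at \<open>\<beta>\<close>. They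
  determine its derivative at \<open>0\<close> without differentiating a series.
\<close>

lemma jain_prob_Suc_ge:
  assumes "0 \<le> \<beta>" "0 \<le> h"
  shows "exp (- h) * h * jain_prob \<beta> k \<beta> \<le> jain_prob \<beta> (Suc k) h"
proof -
  define y where "y = real (Suc k) * \<beta>"
  have y: "\<beta> + real k * \<beta> = y" "0 \<le> y" using assms by (auto simp: y_def algebra_simps)
  have "jain_prob \<beta> k \<beta> = y ^ k / fact (Suc k) * exp (- y)"
  proof (cases k)
    case (Suc j)
    have "\<beta> / fact k * y ^ j = y ^ k / fact (Suc k)"
      using Suc by (simp add: divide_simps) (simp add: y_def algebra_simps)
    moreover have "jain_prob \<beta> k \<beta> = \<beta> / fact k * y ^ j * exp (- y)"
      unfolding jain_prob_def y(1) using Suc by simp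
    ultimately show ?thesis by simp
  qed (simp add: jain_prob_def y_def)
  then have "exp (- h) * h * jain_prob \<beta> k \<beta> = h / fact (Suc k) * y ^ k * exp (- (h + y))"
    by (simp add: exp_diff exp_minus field_simps)
  also have "\<dots> \<le> h / fact (Suc k) * (h + y) ^ k * exp (- (h + y))"
    using assms y by (intro mult_right_mono mult_left_mono power_mono) auto
  also have "\<dots> = jain_prob \<beta> (Suc k) h" by (simp add: jain_prob_def y_def)
  finally show ?thesis .
qed

lemma jain_prob_Suc_le:
  assumes "0 \<le> \<beta>" "0 \<le> h"
  shows "jain_prob \<beta> (Suc k) h \<le> h * jain_prob \<beta> k (h + \<beta>)"
proof (cases k)
  case (Suc j)
  define y where "y = h + real (Suc k) * \<beta>"
  have y: "h + \<beta> + real k * \<beta> = y" "0 \<le> y" using assms by (auto simp: y_def algebra_simps)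
  have "y \<le> real (Suc k) * (h + \<beta>)"
    using assms by (simp add: y_def algebra_simps)
  then have "y / fact (Suc k) \<le> (h + \<beta>) / fact k"
    by (simp add: divide_simps mult_ac)
  then have "y / fact (Suc k) * (h * y ^ j * exp (- y)) \<le> (h + \<beta>) / fact k * (h * y ^ j * exp (- y))"
    using assms y by (intro mult_right_mono) auto
  moreover have "jain_prob \<beta> k (h + \<beta>) = (h + \<beta>) / fact k * y ^ j * exp (- y)"
    unfolding jain_prob_def y(1) using Suc by simp
  moreover have "jain_prob \<beta> (Suc k) h = h / fact (Suc k) * (y * y ^ j) * exp (- y)"
    unfolding jain_prob_def y_def[symmetric] using Suc by simp
  ultimately show ?thesis by (simp add: mult_ac)
qed (simp add: jain_prob_def add.commute)

text \<open>
  Let \<open>N \<alpha>\<close> be the total mass. The convolution identity makes \<open>N\<close> multiplicative, and the sandwich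
  on intervals of length \<open>\<alpha> / n\<close> turns this into \<open>N \<alpha> = exp (\<alpha> * (\<nu> - 1))\<close> with \<open>\<nu> = N \<beta>\<close>. So \<open>\<nu>\<close>
  solves \<open>\<nu> = exp (\<beta> * (\<nu> - 1))\<close>. Besides \<open>\<nu> = 1\<close> this equation has a second solution if
  \<open>0 < \<beta>\<close>, but that one has \<open>\<beta> * \<nu> > 1\<close>, which is excluded by the finiteness of the sum \<open>T 0\<close> of
  the tilted weights: \<open>T 0 * (1 - \<beta> * \<nu>) = 1\<close>.
\<close>

theorem suminf_jain_prob:
  assumes "0 \<le> \<beta>" "\<beta> < 1" "0 \<le> \<alpha>"
  shows "(\<Sum>k. jain_prob \<beta> k \<alpha>) = 1"
proof -
  define N where "N = (\<lambda>x. \<Sum>k. jain_prob \<beta> k x)"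
  define T where "T = (\<lambda>x. \<Sum>k. jain_tilt \<beta> k x)"
  define \<nu> where "\<nu> = N \<beta>"
  have sP: "summable (\<lambda>k. jain_prob \<beta> k x)" if "0 \<le> x" for x
    using that assms by (simp add: summable_jain_prob)
  have N_nonneg: "0 \<le> N x" if "0 \<le> x" for x
    unfolding N_def using that assms by (intro suminf_nonneg sP jain_prob_nonneg)
  have N0: "N 0 = 1"
    using suminf_finite[of "{0}" "\<lambda>k. jain_prob \<beta> k 0"] by (simp add: N_def jain_prob_at_0)
  have T0: "T 0 > 0"
  proof -
    have "jain_tilt \<beta> 0 0 \<le> T 0"
      unfolding T_def using assms
      by (intro sum_le_suminf[of _ "{0}", simplified]) (auto simp: jain_tilt_nonneg summable_jain_tilt)
    then show ?thesis by (simp add: jain_tilt_def)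
  qed
  have T_eq: "T x = N x * T 0" if "0 \<le> x" for x
    using suminf_jain_tilt_add[of \<beta> x 0] that assms by (simp add: T_def N_def)
  have N_add: "N (x + y) = N x * N y" if "0 \<le> x" "0 \<le> y" for x y
  proof -
    have "N (x + y) * T 0 = N x * T y"
      using suminf_jain_tilt_add[of \<beta> x y] that assms T_eq[of "x + y"] by (simp add: T_def N_def)
    then show ?thesis using T0 T_eq[OF that(2)] by simp
  qed
  have N_mult: "N (real n * h) = N h ^ n" if "0 \<le> h" for n h
    using that by (induction n) (simp_all add: N0 N_add algebra_simps)
  have "T 0 = 1 + \<beta> * \<nu> * T 0"
    using suminf_jain_tilt_shift[of \<beta> 0] assms T_eq[of \<beta>] N0 by (simp add: T_def N_def \<nu>_def)
  then have "T 0 * (1 - \<beta> * \<nu>) = 1" by (simp add: algebra_simps)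
  then have \<beta>\<nu>: "\<beta> * \<nu> < 1"
    using T0 by (smt (verit) zero_less_mult_iff)
  have head: "N h = exp (- h) + (\<Sum>k. jain_prob \<beta> (Suc k) h)" if "0 \<le> h" for h
    using suminf_split_head[OF sP[OF that]] by (simp add: N_def jain_prob_def)
  have lower: "exp (- h) * (1 + h * \<nu>) \<le> N h" if "0 \<le> h" for h
  proof -
    have "exp (- h) * h * \<nu> = (\<Sum>k. exp (- h) * h * jain_prob \<beta> k \<beta>)"
      unfolding \<nu>_def N_def using assms by (intro suminf_mult[symmetric] sP)
    also have "\<dots> \<le> (\<Sum>k. jain_prob \<beta> (Suc k) h)"
      using assms that sP by (intro suminf_le jain_prob_Suc_ge summable_mult) (auto simp: summable_jain_prob_Suc)
    finally show ?thesis using head[OF that] by (simp add: algebra_simps)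
  qed
  have upper: "N h * (1 - h * \<nu>) \<le> exp (- h)" if "0 \<le> h" for h
  proof -
    have "(\<Sum>k. jain_prob \<beta> (Suc k) h) \<le> (\<Sum>k. h * jain_prob \<beta> k (h + \<beta>))"
      using assms that sP by (intro suminf_le jain_prob_Suc_le summable_mult) (auto simp: summable_jain_prob_Suc)
    also have "\<dots> = h * (N h * \<nu>)"
      using assms that N_add[of h \<beta>] by (subst suminf_mult) (auto simp: N_def \<nu>_def intro: sP)
    finally show ?thesis using head[OF that] by (simp add: algebra_simps)
  qed
  have \<nu>0: "0 \<le> \<nu>" using assms N_nonneg by (simp add: \<nu>_def)
  have N_exp: "N x = exp (x * (\<nu> - 1))" if "0 \<le> x" for x
  proof (rule antisym)
    have N_root: "N x = N (x / real n) ^ n" if "n > 0" for n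
      using N_mult[of "x / real n" n] that \<open>0 \<le> x\<close> by simp
    have e: "exp (- (x / real n)) ^ n = exp (- x)" if "n > 0" for n
      using that by (simp add: exp_of_nat_mult[symmetric])
    show "exp (x * (\<nu> - 1)) \<le> N x"
    proof (rule tendsto_upperbound)
      show "(\<lambda>n. exp (- x) * (1 + (x * \<nu>) / real n) ^ n) \<longlonglongrightarrow> exp (x * (\<nu> - 1))"
        using tendsto_mult_left[OF tendsto_exp_limit_sequentially[of "x * \<nu>"], of "exp (- x)"]
        by (simp add: mult_exp_exp algebra_simps)
      show "\<forall>\<^sub>F n in sequentially. exp (- x) * (1 + (x * \<nu>) / real n) ^ n \<le> N x"
      proof (rule eventually_sequentiallyI[of 1])
        fix n :: nat assume n: "1 \<le> n"
        then have "(exp (- (x / real n)) * (1 + x / real n * \<nu>)) ^ n \<le> N (x / real n) ^ n"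
          using that \<nu>0 by (intro power_mono lower) auto
        then show "exp (- x) * (1 + (x * \<nu>) / real n) ^ n \<le> N x"
          using n N_root[of n] e[of n] by (simp add: power_mult_distrib)
      qed
    qed simp
    have "N x * exp (- (x * \<nu>)) \<le> exp (- x)"
    proof (rule tendsto_upperbound)
      show "(\<lambda>n. N x * (1 + (- (x * \<nu>)) / real n) ^ n) \<longlonglongrightarrow> N x * exp (- (x * \<nu>))"
        by (intro tendsto_mult_left tendsto_exp_limit_sequentially)
      obtain m :: nat where m: "x * \<nu> < real m" using reals_Archimedean2 by blast
      show "\<forall>\<^sub>F n in sequentially. N x * (1 + (- (x * \<nu>)) / real n) ^ n \<le> exp (- x)"
      proof (rule eventually_sequentiallyI[of "Suc m"])
        fix n :: nat assume n: "Suc m \<le> n"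
        then have "x / real n * \<nu> \<le> 1" using m by (simp add: divide_simps)
        then have "(N (x / real n) * (1 - x / real n * \<nu>)) ^ n \<le> exp (- (x / real n)) ^ n"
          using that n by (intro power_mono upper mult_nonneg_nonneg N_nonneg) auto
        then show "N x * (1 + (- (x * \<nu>)) / real n) ^ n \<le> exp (- x)"
          using n N_root[of n] e[of n] by (simp add: power_mult_distrib)
      qed
    qed simp
    then show "N x \<le> exp (x * (\<nu> - 1))"
      by (simp add: exp_minus exp_diff field_simps)
  qed
  have "\<nu> = 1"
  proof (rule antisym)
    have \<nu>: "\<nu> = exp (\<beta> * (\<nu> - 1))" using N_exp[of \<beta>] assms by (simp add: \<nu>_def)
    have "1 + \<beta> * (\<nu> - 1) \<le> \<nu>" by (subst (2) \<nu>) (rule exp_ge_add_one_self)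
    then have "0 \<le> (1 - \<beta>) * (\<nu> - 1)" by (simp add: algebra_simps)
    then show "1 \<le> \<nu>" using assms by (simp add: zero_le_mult_iff)
    \<comment> \<open>The other bound for \<open>exp\<close> leaves \<open>\<nu> \<le> 1\<close> or \<open>\<beta> * \<nu> \<ge> 1\<close>.\<close>
    have "\<nu> * (1 - \<beta> * (\<nu> - 1)) \<le> \<nu> * exp (- (\<beta> * (\<nu> - 1)))"
      using exp_ge_add_one_self[of "- (\<beta> * (\<nu> - 1))"] \<nu>0 by (intro mult_left_mono) auto
    also have "\<dots> = 1" by (subst (1) \<nu>) (simp add: mult_exp_exp)
    finally have "0 \<le> (\<nu> - 1) * (\<beta> * \<nu> - 1)" by (simp add: algebra_simps)
    then show "\<nu> \<le> 1" using \<beta>\<nu> by (simp add: zero_le_mult_iff)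
  qed
  then show ?thesis using N_exp[OF assms(3)] by (simp add: N_def)
qed

lemma suminf_jain_tilt:
  assumes "0 \<le> \<beta>" "\<beta> < 1" "0 \<le> \<alpha>"
  shows "(\<Sum>k. jain_tilt \<beta> k \<alpha>) = 1 / (1 - \<beta>)"
proof -
  have T: "(\<Sum>k. jain_tilt \<beta> k x) = (\<Sum>k. jain_tilt \<beta> k 0)" if "0 \<le> x" for x
    using suminf_jain_tilt_add[of \<beta> x 0] assms that by (simp add: suminf_jain_prob)
  have "(\<Sum>k. jain_tilt \<beta> k \<alpha>) = 1 + \<beta> * (\<Sum>k. jain_tilt \<beta> k \<alpha>)"
    using suminf_jain_tilt_shift[OF assms] T[of \<alpha>] T[of "\<alpha> + \<beta>"] assms
    by (simp add: suminf_jain_prob)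
  then show ?thesis using assms by (simp add: field_simps)
qed

section \<open>Moments\<close>

definition jain_moment :: "real \<Rightarrow> nat \<Rightarrow> real \<Rightarrow> real" where
  "jain_moment \<beta> r \<alpha> = (\<Sum>k. real k ^ r * jain_prob \<beta> k \<alpha>)"

text \<open>
  A compound Poisson variable is a sum of a Poisson number of jumps. These are the moments of the
  jump sizes \<open>Suc m\<close>, biased by the jump size. Hence the moment of order \<open>0\<close> is the mean jump,
  \<open>1 / (1 - \<beta>)\<close>, and the mean of the distribution is \<open>\<alpha>\<close> times this.
\<close>

definition jump_moment :: "real \<Rightarrow> nat \<Rightarrow> real" where
  "jump_moment \<beta> r = (\<Sum>m. real (Suc m) ^ r * jain_tilt \<beta> m \<beta>)"

lemma jain_moment_0:
  assumes "0 \<le> \<beta>" "\<beta> < 1" "0 \<le> \<alpha>"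
  shows "jain_moment \<beta> 0 \<alpha> = 1"
  using suminf_jain_prob[OF assms] by (simp add: jain_moment_def)

lemma jump_moment_0:
  assumes "0 \<le> \<beta>" "\<beta> < 1"
  shows "jump_moment \<beta> 0 = 1 / (1 - \<beta>)"
  using suminf_jain_tilt[of \<beta> \<beta>] assms by (simp add: jump_moment_def)

lemma summable_jump_moment:
  assumes "0 \<le> \<beta>" "\<beta> < 1"
  shows "summable (\<lambda>m. real (Suc m) ^ r * jain_tilt \<beta> m \<beta>)"
proof -
  have "summable (\<lambda>m. \<Sum>l\<le>r. real (r choose l) * (real m ^ l * jain_tilt \<beta> m \<beta>))"
    using assms by (intro summable_sum summable_mult summable_power_mult_jain_tilt) auto
  also have "(\<lambda>m. \<Sum>l\<le>r. real (r choose l) * (real m ^ l * jain_tilt \<beta> m \<beta>)) =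
      (\<lambda>m. real (Suc m) ^ r * jain_tilt \<beta> m \<beta>)"
  proof
    fix m
    have "real (Suc m) ^ r = (real m + 1) ^ r" by (simp add: add.commute)
    then show "(\<Sum>l\<le>r. real (r choose l) * (real m ^ l * jain_tilt \<beta> m \<beta>)) =
        real (Suc m) ^ r * jain_tilt \<beta> m \<beta>"
      by (simp only: binomial_ring sum_distrib_right mult.assoc power_one mult_1_left)
  qed
  finally show ?thesis .
qed

lemma jain_moment_nonneg: "0 \<le> \<beta> \<Longrightarrow> \<beta> < 1 \<Longrightarrow> 0 \<le> \<alpha> \<Longrightarrow> 0 \<le> jain_moment \<beta> r \<alpha>"
  unfolding jain_moment_def
  by (intro suminf_nonneg summable_power_mult_jain_prob mult_nonneg_nonneg jain_prob_nonneg) auto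

lemma jump_moment_nonneg: "0 \<le> \<beta> \<Longrightarrow> \<beta> < 1 \<Longrightarrow> 0 \<le> jump_moment \<beta> r"
  unfolding jump_moment_def
  by (intro suminf_nonneg summable_jump_moment mult_nonneg_nonneg jain_tilt_nonneg) auto

text \<open>
  For weights \<open>w i = jain_tilt \<beta> i \<beta>\<close>, the size-bias and convolution identities combine to
  \<open>(k + 1) * jain_prob \<beta> (k + 1) \<alpha> = \<alpha> * (\<Sum>i\<le>k. jain_prob \<beta> i \<alpha> * w (k - i))\<close>, Panjer's recursion.
  Multiplying by \<open>(k + 1) ^ r = (i + (k - i + 1)) ^ r\<close> and expanding yields Cauchy products of
  moments.
\<close>

theorem jain_moment_Suc:
  assumes "0 \<le> \<beta>" "\<beta> < 1" "0 \<le> \<alpha>"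
  shows "jain_moment \<beta> (Suc r) \<alpha> =
    \<alpha> * (\<Sum>l\<le>r. real (r choose l) * jump_moment \<beta> (r - l) * jain_moment \<beta> l \<alpha>)"
proof -
  define c where "c = (\<lambda>l k. \<Sum>i\<le>k. (real i ^ l * jain_prob \<beta> i \<alpha>) *
                          (real (Suc (k - i)) ^ (r - l) * jain_tilt \<beta> (k - i) \<beta>))"
  have c: "c l sums (jain_moment \<beta> l \<alpha> * jump_moment \<beta> (r - l))" for l
    unfolding c_def jain_moment_def jump_moment_def
    by (rule Cauchy_product_sums)
      (use assms summable_power_mult_jain_prob summable_jump_moment[OF assms(1,2)]
        in \<open>simp_all add: abs_mult jain_prob_nonneg jain_tilt_nonneg del: of_nat_Suc\<close>)
  have *: "real (Suc k) ^ Suc r * jain_prob \<beta> (Suc k) \<alpha> =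
      \<alpha> * (\<Sum>l\<le>r. real (r choose l) * c l k)" for k
  proof -
    have "real (Suc k) ^ Suc r * jain_prob \<beta> (Suc k) \<alpha> =
        real (Suc k) ^ r * (\<alpha> * jain_tilt \<beta> k (\<alpha> + \<beta>))"
      unfolding jain_prob_size_bias[symmetric] by simp
    also have "\<dots> = \<alpha> * (\<Sum>i\<le>k. real (Suc k) ^ r * (jain_prob \<beta> i \<alpha> * jain_tilt \<beta> (k - i) \<beta>))"
      unfolding jain_tilt_convolution by (simp add: sum_distrib_left mult_ac)
    also have "(\<Sum>i\<le>k. real (Suc k) ^ r * (jain_prob \<beta> i \<alpha> * jain_tilt \<beta> (k - i) \<beta>)) =
       (\<Sum>i\<le>k. \<Sum>l\<le>r. real (r choose l) * ((real i ^ l * jain_prob \<beta> i \<alpha>) *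
                          (real (Suc (k - i)) ^ (r - l) * jain_tilt \<beta> (k - i) \<beta>)))"
    proof (intro sum.cong refl)
      fix i assume "i \<in> {..k}"
      then have "real (Suc k) = real i + real (Suc (k - i))" by simp
      then have "real (Suc k) ^ r = (\<Sum>l\<le>r. real (r choose l) * real i ^ l * real (Suc (k - i)) ^ (r - l))"
        by (simp only: binomial_ring)
      then show "real (Suc k) ^ r * (jain_prob \<beta> i \<alpha> * jain_tilt \<beta> (k - i) \<beta>) =
        (\<Sum>l\<le>r. real (r choose l) * ((real i ^ l * jain_prob \<beta> i \<alpha>) *
                          (real (Suc (k - i)) ^ (r - l) * jain_tilt \<beta> (k - i) \<beta>)))"
        by (simp only: sum_distrib_left sum_distrib_right mult_ac)
    qed
    also have "\<dots> = (\<Sum>l\<le>r. real (r choose l) * c l k)"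
      unfolding c_def sum_distrib_left by (rule sum.swap)
    finally show ?thesis .
  qed
  have "(\<lambda>k. real (Suc k) ^ Suc r * jain_prob \<beta> (Suc k) \<alpha>) sums
      (\<alpha> * (\<Sum>l\<le>r. real (r choose l) * (jain_moment \<beta> l \<alpha> * jump_moment \<beta> (r - l))))"
    unfolding * by (intro sums_mult sums_sum c)
  then have "(\<lambda>k. real k ^ Suc r * jain_prob \<beta> k \<alpha>) sums
      (\<alpha> * (\<Sum>l\<le>r. real (r choose l) * (jain_moment \<beta> l \<alpha> * jump_moment \<beta> (r - l))))"
    by (subst (asm) sums_Suc_iff) simp
  then show ?thesis unfolding jain_moment_def[of \<beta> "Suc r"] by (simp add: sums_iff mult_ac)
qed

lemma jain_moment_le:
  assumes "0 \<le> \<beta>" "\<beta> < 1"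
  shows "\<exists>C\<ge>0. \<forall>\<alpha>\<ge>0. jain_moment \<beta> r \<alpha> \<le> C * (1 + \<alpha>) ^ r"
proof (induction r rule: less_induct)
  case (less r)
  show ?case
  proof (cases r)
    case 0
    then show ?thesis using assms by (intro exI[of _ 1]) (simp add: jain_moment_0)
  next
    case (Suc q)
    have "\<forall>l\<in>{..q}. \<exists>C\<ge>0. \<forall>\<alpha>\<ge>0. jain_moment \<beta> l \<alpha> \<le> C * (1 + \<alpha>) ^ l"
      using less.IH Suc by auto
    then obtain C where C: "\<And>l. l \<le> q \<Longrightarrow> 0 \<le> C l"
      "\<And>l \<alpha>. l \<le> q \<Longrightarrow> 0 \<le> \<alpha> \<Longrightarrow> jain_moment \<beta> l \<alpha> \<le> C l * (1 + \<alpha>) ^ l"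
      by (metis atMost_iff)
    define K where "K = (\<Sum>l\<le>q. real (q choose l) * jump_moment \<beta> (q - l) * C l)"
    have "0 \<le> K" unfolding K_def
      using C(1) assms by (intro sum_nonneg mult_nonneg_nonneg jump_moment_nonneg) auto
    moreover have "jain_moment \<beta> r \<alpha> \<le> K * (1 + \<alpha>) ^ r" if "0 \<le> \<alpha>" for \<alpha>
    proof -
      have "jain_moment \<beta> r \<alpha> =
          \<alpha> * (\<Sum>l\<le>q. real (q choose l) * jump_moment \<beta> (q - l) * jain_moment \<beta> l \<alpha>)"
        using jain_moment_Suc[OF assms that] Suc by simp
      also have "\<dots> \<le> (1 + \<alpha>) *
          (\<Sum>l\<le>q. real (q choose l) * jump_moment \<beta> (q - l) * (C l * (1 + \<alpha>) ^ q))"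
      proof (intro mult_mono sum_mono)
        fix l assume l: "l \<in> {..q}"
        have "jain_moment \<beta> l \<alpha> \<le> C l * (1 + \<alpha>) ^ l" using C(2) l that by simp
        also have "\<dots> \<le> C l * (1 + \<alpha>) ^ q"
          using C(1) l that by (intro mult_left_mono power_increasing) auto
        finally show "jain_moment \<beta> l \<alpha> \<le> C l * (1 + \<alpha>) ^ q" .
      qed (use that assms in \<open>auto intro!: sum_nonneg mult_nonneg_nonneg jump_moment_nonneg jain_moment_nonneg\<close>)
      also have "\<dots> = K * (1 + \<alpha>) ^ r"
        by (simp add: K_def Suc sum_distrib_left sum_distrib_right mult_ac)
      finally show ?thesis .
    qed
    ultimately show ?thesis by blast
  qed
qed

text \<open>
  The term \<open>l = r\<close> of the recursion is exactly \<open>\<mu> * jain_moment \<beta> r \<alpha>\<close> with the mean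
  \<open>\<mu> = \<alpha> / (1 - \<beta>)\<close>. What remains is nonnegative and of lower degree in \<open>\<alpha>\<close>.
\<close>

lemma jain_moment_Suc_diff:
  assumes "0 \<le> \<beta>" "\<beta> < 1" "0 \<le> \<alpha>"
  shows "jain_moment \<beta> (Suc r) \<alpha> - \<alpha> / (1 - \<beta>) * jain_moment \<beta> r \<alpha> =
    \<alpha> * (\<Sum>l<r. real (r choose l) * jump_moment \<beta> (r - l) * jain_moment \<beta> l \<alpha>)"
  unfolding jain_moment_Suc[OF assms] lessThan_Suc_atMost[symmetric]
  using assms by (simp add: jump_moment_0 algebra_simps)

lemma jain_central_moment_eq:
  assumes "0 \<le> \<beta>" "\<beta> < 1" "0 \<le> \<alpha>"
  defines "\<mu> \<equiv> \<alpha> / (1 - \<beta>)"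
  shows "(\<lambda>k. (real k - \<mu>)\<^sup>2 * real k ^ p * jain_prob \<beta> k \<alpha>) sums
    (jain_moment \<beta> (Suc (Suc p)) \<alpha> - \<mu> * jain_moment \<beta> (Suc p) \<alpha>
      - \<mu> * (jain_moment \<beta> (Suc p) \<alpha> - \<mu> * jain_moment \<beta> p \<alpha>))"
proof -
  have m: "(\<lambda>k. real k ^ r * jain_prob \<beta> k \<alpha>) sums jain_moment \<beta> r \<alpha>" for r
    unfolding jain_moment_def using assms(1-3) by (intro summable_sums summable_power_mult_jain_prob)
  have "(\<lambda>k. real k ^ Suc (Suc p) * jain_prob \<beta> k \<alpha> - \<mu> * (real k ^ Suc p * jain_prob \<beta> k \<alpha>)
      - \<mu> * (real k ^ Suc p * jain_prob \<beta> k \<alpha> - \<mu> * (real k ^ p * jain_prob \<beta> k \<alpha>))) sums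
    (jain_moment \<beta> (Suc (Suc p)) \<alpha> - \<mu> * jain_moment \<beta> (Suc p) \<alpha>
      - \<mu> * (jain_moment \<beta> (Suc p) \<alpha> - \<mu> * jain_moment \<beta> p \<alpha>))"
    by (intro sums_diff sums_mult m)
  moreover have "(\<lambda>k. real k ^ Suc (Suc p) * jain_prob \<beta> k \<alpha> - \<mu> * (real k ^ Suc p * jain_prob \<beta> k \<alpha>)
      - \<mu> * (real k ^ Suc p * jain_prob \<beta> k \<alpha> - \<mu> * (real k ^ p * jain_prob \<beta> k \<alpha>))) =
    (\<lambda>k. (real k - \<mu>)\<^sup>2 * real k ^ p * jain_prob \<beta> k \<alpha>)"
    by (rule ext) (simp add: power2_eq_square algebra_simps)
  ultimately show ?thesis by simp
qed

text \<open>
  With \<open>d r = E (k - \<mu>) * k ^ r\<close> the left hand side is \<open>d (p + 1) - \<mu> * d p\<close>. As \<open>d p \<ge> 0\<close>, it is at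
  most \<open>d (p + 1)\<close>, which by the previous recursion is \<open>\<alpha>\<close> times a combination of moments of order
  at most \<open>p\<close>. So the cancellation of the leading power of \<open>\<alpha>\<close> has to be exploited only once.
\<close>

theorem jain_central_moment_le:
  assumes "0 \<le> \<beta>" "\<beta> < 1"
  shows "\<exists>C\<ge>0. \<forall>\<alpha>\<ge>0. (\<Sum>k. (real k - \<alpha> / (1 - \<beta>))\<^sup>2 * real k ^ p * jain_prob \<beta> k \<alpha>)
    \<le> C * \<alpha> * (1 + \<alpha>) ^ p"
proof -
  obtain C where C: "\<And>l. 0 \<le> C l" "\<And>l \<alpha>. 0 \<le> \<alpha> \<Longrightarrow> jain_moment \<beta> l \<alpha> \<le> C l * (1 + \<alpha>) ^ l"
    using jain_moment_le[OF assms] by metis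
  define K where "K = (\<Sum>l<Suc p. real (Suc p choose l) * jump_moment \<beta> (Suc p - l) * C l)"
  have "0 \<le> K" unfolding K_def
    using C(1) assms by (intro sum_nonneg mult_nonneg_nonneg jump_moment_nonneg) auto
  moreover have "(\<Sum>k. (real k - \<alpha> / (1 - \<beta>))\<^sup>2 * real k ^ p * jain_prob \<beta> k \<alpha>)
    \<le> K * \<alpha> * (1 + \<alpha>) ^ p" if \<alpha>: "0 \<le> \<alpha>" for \<alpha>
  proof -
    define \<mu> where "\<mu> = \<alpha> / (1 - \<beta>)"
    define d where "d = (\<lambda>r. jain_moment \<beta> (Suc r) \<alpha> - \<mu> * jain_moment \<beta> r \<alpha>)"
    have d: "d r = \<alpha> * (\<Sum>l<r. real (r choose l) * jump_moment \<beta> (r - l) * jain_moment \<beta> l \<alpha>)" for r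
      using jain_moment_Suc_diff[OF assms \<alpha>] by (simp add: d_def \<mu>_def)
    have "0 \<le> d p" unfolding d
      using assms \<alpha> by (intro sum_nonneg mult_nonneg_nonneg jump_moment_nonneg jain_moment_nonneg) auto
    moreover have "0 \<le> \<mu>" using assms \<alpha> by (simp add: \<mu>_def)
    moreover have "(\<Sum>k. (real k - \<mu>)\<^sup>2 * real k ^ p * jain_prob \<beta> k \<alpha>) = d (Suc p) - \<mu> * d p"
      using jain_central_moment_eq[OF assms \<alpha>, of p] unfolding \<mu>_def[symmetric] d_def by (simp add: sums_iff)
    ultimately have "(\<Sum>k. (real k - \<mu>)\<^sup>2 * real k ^ p * jain_prob \<beta> k \<alpha>) \<le> d (Suc p)"
      by simp
    also have "\<dots> \<le> \<alpha> * (\<Sum>l<Suc p. real (Suc p choose l) * jump_moment \<beta> (Suc p - l) * (C l * (1 + \<alpha>) ^ p))"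
      unfolding d
    proof (intro mult_left_mono sum_mono)
      fix l assume l: "l \<in> {..<Suc p}"
      have "jain_moment \<beta> l \<alpha> \<le> C l * (1 + \<alpha>) ^ l" using C(2) \<alpha> by simp
      also have "\<dots> \<le> C l * (1 + \<alpha>) ^ p"
        using C(1) l \<alpha> by (intro mult_left_mono power_increasing) auto
      finally show "jain_moment \<beta> l \<alpha> \<le> C l * (1 + \<alpha>) ^ p" .
    qed (use \<alpha> assms in \<open>auto intro!: mult_nonneg_nonneg jump_moment_nonneg\<close>)
    also have "\<dots> = K * \<alpha> * (1 + \<alpha>) ^ p"
      unfolding K_def sum_distrib_left sum_distrib_right by (intro sum.cong refl) (simp only: mult_ac)
    finally show ?thesis by (simp add: \<mu>_def)
  qed
  ultimately show ?thesis by blast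
qed

section \<open>Secants and second differences\<close>

lemma quadratic_growth_of_bounded_second_difference:
  fixes c :: "nat \<Rightarrow> real"
  assumes c0: "\<bar>c 0\<bar> \<le> S" and c1: "\<bar>c 1\<bar> \<le> 2 * S"
    and d: "\<And>j. j + 2 \<le> m \<Longrightarrow> \<bar>c j - 2 * c (j + 1) + c (j + 2)\<bar> \<le> S"
  shows "\<bar>c m\<bar> \<le> (1 + 3 * real m + (real m)\<^sup>2) * S"
proof -
  have S: "0 \<le> S" using c0 by linarith
  have step: "\<bar>c (Suc j) - c j\<bar> \<le> (3 + real j) * S" if "Suc j \<le> m" for j
    using that
  proof (induction j)
    case 0
    then show ?case using c0 c1 by simp
  next
    case (Suc j)
    have "\<bar>c (Suc (Suc j)) - c (Suc j)\<bar> \<le> \<bar>c (Suc j) - c j\<bar> + S"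
      using d[of j] Suc.prems by simp
    also have "\<dots> \<le> (3 + real j) * S + S" using Suc by simp
    finally show ?case by (simp add: algebra_simps)
  qed
  have "\<bar>c j\<bar> \<le> (1 + 3 * real j + (real j)\<^sup>2) * S" if "j \<le> m" for j
    using that
  proof (induction j)
    case 0
    then show ?case using c0 by simp
  next
    case (Suc j)
    have "\<bar>c (Suc j)\<bar> \<le> \<bar>c j\<bar> + \<bar>c (Suc j) - c j\<bar>" by simp
    also have "\<dots> \<le> (1 + 3 * real j + (real j)\<^sup>2) * S + (3 + real j) * S"
      using Suc step[of j] by (intro add_mono) auto
    also have "\<dots> = (1 + 3 * real j + (real j)\<^sup>2 + (3 + real j)) * S" by (simp add: algebra_simps)
    also have "\<dots> \<le> (1 + 3 * real (Suc j) + (real (Suc j))\<^sup>2) * S"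
      using S by (intro mult_right_mono) (auto simp: power2_eq_square algebra_simps)
    finally show ?case .
  qed
  then show ?thesis by simp
qed

definition secant :: "(real \<Rightarrow> real) \<Rightarrow> real \<Rightarrow> real \<Rightarrow> real \<Rightarrow> real" where
  "secant f z t y = f z + (y - z) / t * (f (z + t) - f z)"

lemma diff2_minus_secant: "diff2 h (\<lambda>y. f y - secant f z t y) u = diff2 h f u"
proof -
  define q where "q = (f (z + t) - f z) / t"
  have "secant f z t y = f z + (y - z) * q" for y by (simp add: secant_def q_def)
  then show ?thesis unfolding diff2_def by (simp only:) (simp add: algebra_simps)
qed

text \<open>
  Let \<open>v\<close> be a maximum point of \<open>\<bar>g\<bar>\<close>, where \<open>g\<close> is the error. The second difference centred at
  \<open>v\<close> with one end at the nearer node involves \<open>0\<close>, \<open>-2 * g v\<close> and a value of size at most \<open>\<bar>g v\<bar>\<close>.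
\<close>

lemma secant_error_inside:
  fixes f :: "real \<Rightarrow> real"
  assumes t: "0 < t" and cont: "continuous_on {z..z+t} f"
    and d: "\<And>u h. z \<le> u \<Longrightarrow> 0 \<le> h \<Longrightarrow> u + 2 * h \<le> z + t \<Longrightarrow> \<bar>diff2 h f u\<bar> \<le> S"
    and y: "y \<in> {z..z+t}"
  shows "\<bar>f y - secant f z t y\<bar> \<le> S"
proof -
  define g where "g = (\<lambda>y. f y - secant f z t y)"
  have g0: "g z = 0" "g (z + t) = 0" using t by (auto simp: g_def secant_def)
  have dg: "\<bar>g u - 2 * g (u + h) + g (u + 2 * h)\<bar> \<le> S"
    if "z \<le> u" "0 \<le> h" "u + 2 * h \<le> z + t" for u h
    using d[OF that] diff2_minus_secant[of h f z t u] unfolding g_def diff2_def by simp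
  have "continuous_on {z..z+t} (\<lambda>y. \<bar>g y\<bar>)"
    unfolding g_def secant_def using t by (intro continuous_intros cont) auto
  then obtain v where v: "v \<in> {z..z+t}" and max: "\<And>w. w \<in> {z..z+t} \<Longrightarrow> \<bar>g w\<bar> \<le> \<bar>g v\<bar>"
    using continuous_attains_sup[of "{z..z+t}" "\<lambda>y. \<bar>g y\<bar>"] t by auto
  have "\<bar>g v\<bar> \<le> S"
  proof (cases "v - z \<le> t / 2")
    case True
    then have "\<bar>g z - 2 * g v + g (2 * v - z)\<bar> \<le> S"
      using dg[of z "v - z"] v by (simp add: algebra_simps)
    moreover have "\<bar>g (2 * v - z)\<bar> \<le> \<bar>g v\<bar>" using True v by (intro max) auto
    ultimately show ?thesis using g0 by linarith
  next
    case False
    then have "\<bar>g (2 * v - z - t) - 2 * g v + g (z + t)\<bar> \<le> S"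
      using dg[of "2 * v - z - t" "z + t - v"] v by (simp add: algebra_simps)
    moreover have "\<bar>g (2 * v - z - t)\<bar> \<le> \<bar>g v\<bar>" using False v by (intro max) auto
    ultimately show ?thesis using g0 by linarith
  qed
  then show ?thesis using max[OF y] unfolding g_def by linarith
qed

text \<open>
  From \<open>y\<close>, walk with steps \<open>t\<close> into the interval between the nodes, where the error is at most \<open>S\<close>.
  The errors along the walk have second differences bounded by \<open>S\<close>, so it remains to bound the
  first value outside the nodes: it is obtained by reflecting at a node, where the error vanishes.
  A bound of higher degree in \<open>(y - z) / t\<close> would be of no use later: for small \<open>x\<close>, only the second
  moment of \<open>y - z\<close> stays bounded relative to the corresponding power of \<open>t\<close>.
\<close>

theorem secant_error:
  fixes f :: "real \<Rightarrow> real"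
  assumes t: "0 < t" and cont: "continuous_on {A..B} f"
    and zA: "A \<le> z" and zB: "z + t \<le> B"
    and d: "\<And>u h. A \<le> u \<Longrightarrow> 0 \<le> h \<Longrightarrow> h \<le> t \<Longrightarrow> u + 2 * h \<le> B \<Longrightarrow> \<bar>diff2 h f u\<bar> \<le> S"
    and y: "y \<in> {A..B}"
  shows "\<bar>f y - secant f z t y\<bar> \<le> 8 * (1 + ((y - z) / t)\<^sup>2) * S"
proof -
  define g where "g = (\<lambda>y. f y - secant f z t y)"
  have g0: "g z = 0" "g (z + t) = 0" using t by (auto simp: g_def secant_def)
  have dg: "\<bar>g u - 2 * g (u + h) + g (u + 2 * h)\<bar> \<le> S"
    if "A \<le> u" "0 \<le> h" "h \<le> t" "u + 2 * h \<le> B" for u h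
    using d[OF that] diff2_minus_secant[of h f z t u] unfolding g_def diff2_def by simp
  have inside: "\<bar>g w\<bar> \<le> S" if "w \<in> {z..z+t}" for w
    unfolding g_def
  proof (rule secant_error_inside[OF t _ _ that])
    show "continuous_on {z..z+t} f" by (rule continuous_on_subset[OF cont]) (use zA zB in auto)
    show "\<bar>diff2 h f u\<bar> \<le> S" if "z \<le> u" "0 \<le> h" "u + 2 * h \<le> z + t" for u h
      using that zA zB by (intro d) auto
  qed
  have S: "0 \<le> S" using inside[of z] t g0 by simp
  define \<tau> where "\<tau> = \<bar>y - z\<bar> / t"
  have \<tau>: "0 \<le> \<tau>" using t by (simp add: \<tau>_def)
  have "\<exists>m. real m \<le> \<tau> + 1 \<and> \<bar>g y\<bar> \<le> (1 + 3 * real m + (real m)\<^sup>2) * S"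
  proof (cases "z \<le> y")
    case True
    define m where "m = nat \<lfloor>\<tau>\<rfloor>"
    have m: "real m \<le> \<tau>" "\<tau> < real m + 1" using \<tau> by (auto simp: m_def)
    define v where "v = y - real m * t"
    have v: "z \<le> v" "v \<le> z + t"
      using m t True by (auto simp: v_def \<tau>_def field_simps)
    define c where "c = (\<lambda>j. g (v + real j * t))"
    have "\<bar>c m\<bar> \<le> (1 + 3 * real m + (real m)\<^sup>2) * S" if "m > 0"
    proof (rule quadratic_growth_of_bounded_second_difference)
      show "\<bar>c 0\<bar> \<le> S" using inside v by (simp add: c_def)
      have "v + t \<le> B"
      proof -
        have "1 * t \<le> real m * t" using that t by (intro mult_right_mono) auto
        then show ?thesis using y by (simp add: v_def)
      qed
      then have "\<bar>g (2 * z + t - v) - 2 * g (z + t) + g (v + t)\<bar> \<le> S"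
        using dg[of "2 * z + t - v" "v - z"] v zA by (simp add: algebra_simps)
      moreover have "\<bar>g (2 * z + t - v)\<bar> \<le> S" using v by (intro inside) auto
      ultimately show "\<bar>c 1\<bar> \<le> 2 * S" using g0 by (simp add: c_def)
      fix j assume "j + 2 \<le> m"
      then have "real (j + 2) * t \<le> real m * t" using t by (intro mult_right_mono) auto
      then have "v + real j * t + 2 * t \<le> B" using y by (simp add: v_def algebra_simps)
      moreover have "0 \<le> real j * t" using t by simp
      then have "A \<le> v + real j * t" using v zA by linarith
      ultimately show "\<bar>c j - 2 * c (j + 1) + c (j + 2)\<bar> \<le> S"
        using dg[of "v + real j * t" t] t by (simp add: c_def algebra_simps)
    qed
    moreover have "\<bar>c 0\<bar> \<le> S" using inside v by (simp add: c_def)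
    moreover have "c m = g y" by (simp add: c_def v_def)
    ultimately have "\<bar>g y\<bar> \<le> (1 + 3 * real m + (real m)\<^sup>2) * S"
      by (cases "m = 0") auto
    then show ?thesis using m by (intro exI[of _ m]) auto
  next
    case False
    define m where "m = nat \<lceil>\<tau>\<rceil>"
    have m: "real m < \<tau> + 1" "\<tau> \<le> real m" using \<tau> by (auto simp: m_def) linarith+
    define v where "v = y + real m * t"
    have v: "z \<le> v" "v \<le> z + t"
      using m t False by (auto simp: v_def \<tau>_def field_simps)
    define c where "c = (\<lambda>j. g (v - real j * t))"
    have "\<bar>c m\<bar> \<le> (1 + 3 * real m + (real m)\<^sup>2) * S"
    proof (rule quadratic_growth_of_bounded_second_difference)
      show "\<bar>c 0\<bar> \<le> S" using inside v by (simp add: c_def)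
      have "A \<le> v - t"
      proof -
        have "0 < \<tau>" using False t by (simp add: \<tau>_def)
        then have "1 \<le> real m" using m by simp
        then have "1 * t \<le> real m * t" using t by (intro mult_right_mono) auto
        then show ?thesis using y by (simp add: v_def)
      qed
      then have "\<bar>g (v - t) - 2 * g z + g (2 * z + t - v)\<bar> \<le> S"
        using dg[of "v - t" "z + t - v"] v zB by (simp add: algebra_simps)
      moreover have "\<bar>g (2 * z + t - v)\<bar> \<le> S" using v by (intro inside) auto
      ultimately show "\<bar>c 1\<bar> \<le> 2 * S" using g0 by (simp add: c_def)
      fix j assume "j + 2 \<le> m"
      then have "real (j + 2) * t \<le> real m * t" using t by (intro mult_right_mono) auto
      then have "A \<le> v - real (j + 2) * t" using y by (simp add: v_def)
      moreover have "v - real (j + 2) * t + 2 * t \<le> B"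
      proof -
        have "0 \<le> real j * t" using t by simp
        then have "v - real j * t \<le> B" using v zB by linarith
        then show ?thesis by (simp add: algebra_simps)
      qed
      ultimately have "\<bar>c (j + 2) - 2 * c (j + 1) + c j\<bar> \<le> S"
        using dg[of "v - real (j + 2) * t" t] t by (simp add: c_def algebra_simps)
      then show "\<bar>c j - 2 * c (j + 1) + c (j + 2)\<bar> \<le> S" by (simp add: algebra_simps)
    qed
    moreover have "c m = g y" by (simp add: c_def v_def)
    ultimately show ?thesis using m by (intro exI[of _ m]) auto
  qed
  then obtain m where m: "real m \<le> \<tau> + 1" "\<bar>g y\<bar> \<le> (1 + 3 * real m + (real m)\<^sup>2) * S" by blast
  have "1 + 3 * w + w\<^sup>2 \<le> 8 * (1 + \<tau>\<^sup>2)" if "0 \<le> w" "w \<le> \<tau> + 1" for w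
  proof -
    have "w\<^sup>2 \<le> (\<tau> + 1)\<^sup>2" using that by (intro power_mono) auto
    then have "w\<^sup>2 \<le> \<tau>\<^sup>2 + 2 * \<tau> + 1" by (simp add: power2_sum)
    moreover have "2 * \<tau> \<le> \<tau>\<^sup>2 + 1" using zero_le_power2[of "\<tau> - 1"] by (simp add: power2_diff)
    moreover have "0 \<le> \<tau>\<^sup>2" by simp
    ultimately show ?thesis using that by argo
  qed
  from this[of "real m"] have "1 + 3 * real m + (real m)\<^sup>2 \<le> 8 * (1 + \<tau>\<^sup>2)"
    using m(1) by simp
  then have "\<bar>g y\<bar> \<le> 8 * (1 + \<tau>\<^sup>2) * S"
    using m(2) S by (meson mult_right_mono order_trans)
  moreover have "\<tau>\<^sup>2 = ((y - z) / t)\<^sup>2" by (simp add: \<tau>_def power_divide)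
  ultimately show ?thesis unfolding g_def by simp
qed

section \<open>Weighted spaces and moduli\<close>

lemma weight_pos: "0 \<le> x \<Longrightarrow> 0 < weight p x"
  by (simp add: weight_def add_pos_nonneg)

lemma weight_le_1: "0 \<le> x \<Longrightarrow> weight p x \<le> 1"
  by (simp add: weight_def inverse_le_1_iff)

lemma weight_antimono: "0 \<le> x \<Longrightarrow> x \<le> y \<Longrightarrow> weight p y \<le> weight p x"
  by (auto simp: weight_def add_pos_nonneg intro!: le_imp_inverse_le power_mono)

lemma weight_mult_le_2: "0 \<le> x \<Longrightarrow> weight p x * (1 + x ^ p) \<le> 2"
  by (simp add: weight_def) (smt (verit) left_inverse zero_le_power)

lemma abs_le_of_weight_mult_le:
  assumes "0 \<le> x" "weight p x * \<bar>v\<bar> \<le> K"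
  shows "\<bar>v\<bar> \<le> K * (1 + x ^ p)"
proof -
  have K: "0 \<le> K" using assms weight_pos[of x p] by (smt (verit) mult_nonneg_nonneg)
  show ?thesis
  proof (cases "p = 0")
    case True
    then show ?thesis using assms K by (simp add: weight_def)
  next
    case False
    have "0 < 1 + x ^ p" using assms(1) by (simp add: add_pos_nonneg)
    then show ?thesis using assms(2) False by (simp add: weight_def field_simps)
  qed
qed

text \<open>
  The weight at \<open>x\<close> absorbs the \<open>p\<close>-th power of every point that is at most a fixed multiple of
  \<open>1 + x\<close>. This is how values at shifted points are controlled in the weighted norm at \<open>x\<close>.
\<close>

lemma weight_mult_power_le:
  assumes "0 \<le> x" "0 \<le> C" "0 \<le> y" "y \<le> C * (1 + x)"
  shows "weight p x * (1 + y ^ p) \<le> 1 + 2 * (2 * C) ^ p"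
proof -
  have "(1 + x) ^ p \<le> (2 * max 1 x) ^ p"
    using assms by (intro power_mono) auto
  also have "\<dots> \<le> 2 ^ p * (1 + x ^ p)"
    using assms by (auto simp: power_mult_distrib max_def)
  finally have "C ^ p * (1 + x) ^ p \<le> C ^ p * (2 ^ p * (1 + x ^ p))"
    using assms by (intro mult_left_mono) auto
  moreover have "y ^ p \<le> C ^ p * (1 + x) ^ p"
    using assms power_mono[OF assms(4,3), of p] by (simp add: power_mult_distrib)
  ultimately have "y ^ p \<le> (2 * C) ^ p * (1 + x ^ p)" by (simp add: power_mult_distrib mult_ac)
  then have "weight p x * y ^ p \<le> weight p x * ((2 * C) ^ p * (1 + x ^ p))"
    using weight_pos[OF assms(1), of p] by (intro mult_left_mono) auto
  also have "\<dots> = (2 * C) ^ p * (weight p x * (1 + x ^ p))" by simp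
  also have "\<dots> \<le> (2 * C) ^ p * 2"
    using weight_mult_le_2[OF assms(1), of p] assms by (intro mult_left_mono) auto
  finally show ?thesis using weight_le_1[OF assms(1), of p] by (simp add: algebra_simps)
qed

lemma B_space_bound:
  assumes "f \<in> B_space p"
  shows "\<exists>M\<ge>0. \<forall>x\<ge>0. \<bar>f x\<bar> \<le> M * (1 + x ^ p)"
proof -
  obtain M where M: "\<And>x. 0 \<le> x \<Longrightarrow> \<bar>f x * weight p x\<bar> \<le> M"
    using assms by (auto simp: B_space_def bounded_iff)
  have "\<bar>f x\<bar> \<le> M * (1 + x ^ p)" if "0 \<le> x" for x
    using M[OF that] weight_pos[OF that, of p] that
    by (intro abs_le_of_weight_mult_le) (auto simp: abs_mult mult.commute)
  moreover have "0 \<le> M" using M[of 0] by simp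
  ultimately show ?thesis by blast
qed

text \<open>
  The suprema in both moduli are therefore taken over bounded sets, which is what allows a single
  difference to be estimated by them.
\<close>

lemma B_space_shift_bound:
  assumes "f \<in> B_space p" "0 \<le> T"
  shows "\<exists>K. \<forall>s x. 0 \<le> s \<longrightarrow> s \<le> T \<longrightarrow> 0 \<le> x \<longrightarrow> weight p x * \<bar>f (x + s)\<bar> \<le> K"
proof -
  obtain M where M: "0 \<le> M" "\<And>x. 0 \<le> x \<Longrightarrow> \<bar>f x\<bar> \<le> M * (1 + x ^ p)"
    using B_space_bound[OF assms(1)] by metis
  have "weight p x * \<bar>f (x + s)\<bar> \<le> M * (1 + 2 * (2 * (1 + T)) ^ p)" if "0 \<le> s" "s \<le> T" "0 \<le> x" for s x
  proof -
    have "weight p x * \<bar>f (x + s)\<bar> \<le> weight p x * (M * (1 + (x + s) ^ p))"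
      using that M weight_pos[of x p] by (intro mult_left_mono) auto
    also have "\<dots> = M * (weight p x * (1 + (x + s) ^ p))" by simp
    also have "\<dots> \<le> M * (1 + 2 * (2 * (1 + T)) ^ p)"
    proof (intro mult_left_mono weight_mult_power_le M)
      have "0 \<le> T * x" using assms that by simp
      moreover have "(1 + T) * (1 + x) = 1 + x + T + T * x" by (simp add: algebra_simps)
      ultimately show "x + s \<le> (1 + T) * (1 + x)" using that by linarith
    qed (use that assms in auto)
    finally show ?thesis .
  qed
  then show ?thesis by blast
qed

lemma weight_mult_le_SUP_wnorm:
  assumes K: "\<And>h x. 0 \<le> h \<Longrightarrow> h \<le> t \<Longrightarrow> 0 \<le> x \<Longrightarrow> weight p x * \<bar>D h x\<bar> \<le> K"
    and "0 \<le> h" "h \<le> t" "0 \<le> x"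
  shows "weight p x * \<bar>D h x\<bar> \<le> (SUP h\<in>{0..t}. wnorm p (D h))"
proof -
  have "weight p x * \<bar>D h x\<bar> \<le> wnorm p (D h)"
    unfolding wnorm_def using assms by (intro cSUP_upper bdd_aboveI2[where M = K]) auto
  also have "\<dots> \<le> (SUP h\<in>{0..t}. wnorm p (D h))"
  proof (intro cSUP_upper bdd_aboveI2[where M = K])
    show "wnorm p (D h) \<le> K" if "h \<in> {0..t}" for h
      unfolding wnorm_def using that K by (intro cSUP_least) auto
  qed (use assms in auto)
  finally show ?thesis .
qed

lemma weight_mult_diff1_le_modulus1:
  assumes "f \<in> B_space p" "0 \<le> h" "h \<le> t" "0 \<le> x"
  shows "weight p x * \<bar>diff1 h f x\<bar> \<le> modulus1 p f t"
proof -
  obtain K where K: "\<And>s x. 0 \<le> s \<Longrightarrow> s \<le> t \<Longrightarrow> 0 \<le> x \<Longrightarrow> weight p x * \<bar>f (x + s)\<bar> \<le> K"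
    using B_space_shift_bound[OF assms(1), of t] assms(2,3) by (meson order_trans)
  show ?thesis unfolding modulus1_def
  proof (rule weight_mult_le_SUP_wnorm[where D = "\<lambda>h. diff1 h f" and K = "2 * K"])
    fix h x :: real assume h: "0 \<le> h" "h \<le> t" "0 \<le> x"
    have "weight p x * \<bar>diff1 h f x\<bar> \<le> weight p x * (\<bar>f (x + h)\<bar> + \<bar>f (x + 0)\<bar>)"
      using weight_pos[OF h(3), of p] unfolding diff1_def by (intro mult_left_mono) auto
    also have "\<dots> \<le> K + K" unfolding distrib_left using h by (intro add_mono K) auto
    finally show "weight p x * \<bar>diff1 h f x\<bar> \<le> 2 * K" by simp
  qed (use assms in auto)
qed

lemma weight_mult_diff2_le_modulus2:
  assumes "f \<in> B_space p" "0 \<le> h" "h \<le> t" "0 \<le> x"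
  shows "weight p x * \<bar>diff2 h f x\<bar> \<le> modulus2 p f t"
proof -
  obtain K where K: "\<And>s x. 0 \<le> s \<Longrightarrow> s \<le> 2 * t \<Longrightarrow> 0 \<le> x \<Longrightarrow> weight p x * \<bar>f (x + s)\<bar> \<le> K"
    using B_space_shift_bound[OF assms(1), of "2 * t"] assms(2,3) by (metis mult_nonneg_nonneg order_trans zero_le_numeral)
  show ?thesis unfolding modulus2_def
  proof (rule weight_mult_le_SUP_wnorm[where D = "\<lambda>h. diff2 h f" and K = "4 * K"])
    fix h x :: real assume h: "0 \<le> h" "h \<le> t" "0 \<le> x"
    have "weight p x * \<bar>diff2 h f x\<bar> \<le>
        weight p x * (\<bar>f (x + 0)\<bar> + (\<bar>f (x + h)\<bar> + (\<bar>f (x + h)\<bar> + \<bar>f (x + 2 * h)\<bar>)))"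
      using weight_pos[OF h(3), of p] unfolding diff2_def by (intro mult_left_mono) auto
    also have "\<dots> \<le> K + (K + (K + K))"
      unfolding distrib_left using h by (intro add_mono K) auto
    finally show "weight p x * \<bar>diff2 h f x\<bar> \<le> 4 * K" by simp
  qed (use assms in auto)
qed

lemma modulus2_nonneg:
  assumes "f \<in> B_space p" "0 \<le> t"
  shows "0 \<le> modulus2 p f t"
  using weight_mult_diff2_le_modulus2[OF assms(1), of 0 t 0] assms(2) by (simp add: diff2_def)

lemma abs_diff2_le:
  assumes "f \<in> B_space p" "0 \<le> h" "h \<le> t" "0 \<le> u" "u ^ p \<le> R"
  shows "\<bar>diff2 h f u\<bar> \<le> modulus2 p f t * (1 + R)"
proof -
  have "\<bar>diff2 h f u\<bar> \<le> modulus2 p f t * (1 + u ^ p)"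
    using assms by (intro abs_le_of_weight_mult_le weight_mult_diff2_le_modulus2) auto
  also have "\<dots> \<le> modulus2 p f t * (1 + R)"
    using assms modulus2_nonneg[OF assms(1), of t] by (intro mult_left_mono) auto
  finally show ?thesis .
qed

lemma C_space_continuous_on:
  assumes "f \<in> C_space p" "A \<subseteq> {0..}"
  shows "continuous_on A f"
proof -
  have "continuous_on {0..} (\<lambda>x. f x * weight p x)"
    using assms uniformly_continuous_imp_continuous by (auto simp: C_space_def)
  moreover have "continuous_on {0..} (weight p)"
  proof -
    have "1 + x ^ p \<noteq> 0" if "0 \<le> x" for x :: real
      using that by (smt (verit) zero_le_power)
    then show ?thesis unfolding weight_def by (cases "p = 0") (auto intro!: continuous_intros)
  qed
  ultimately have "continuous_on {0..} (\<lambda>x. f x * weight p x / weight p x)"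
    using weight_pos by (intro continuous_on_divide) (auto simp: less_imp_neq[symmetric] dest!: weight_pos[of _ p])
  then have "continuous_on {0..} f"
  proof (rule continuous_on_eq)
    show "f x * weight p x / weight p x = f x" if "x \<in> {0..}" for x
      using that weight_pos[of x p] by simp
  qed
  then show ?thesis using assms(2) continuous_on_subset by blast
qed

section \<open>The two parts of the error\<close>

text \<open>
  The secant through \<open>y\<close> and \<open>y + t\<close> with \<open>y = min x z\<close> is evaluated at \<open>max x z\<close>. Starting at the
  minimum matters twice: the step of length \<open>t\<close> goes upwards and stays
  in the domain, and the weight at \<open>y\<close> is at least the weight at
  \<open>x\<close>, so the first modulus occurs without a constant.
\<close>

lemma weighted_shift_le:
  assumes f: "f \<in> C_space p" and x: "0 \<le> x" and z: "0 \<le> z" and t: "0 < t"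
    and zx: "\<bar>z - x\<bar> \<le> t" and K: "x + t \<le> K * (1 + x)"
  shows "weight p x * \<bar>f z - f x\<bar> \<le>
    \<bar>z - x\<bar> / t * modulus1 p f t + (1 + 2 * (2 * K) ^ p) * modulus2 p f t"
proof -
  define y where "y = min x z"
  define \<delta> where "\<delta> = \<bar>z - x\<bar>"
  define S where "S = modulus2 p f t * (1 + (x + t) ^ p)"
  have fB: "f \<in> B_space p" using f by (simp add: C_space_def)
  have y: "0 \<le> y" "y \<le> x" using x z by (auto simp: y_def)
  have K0: "0 \<le> K" using K x t by (smt (verit) mult_nonneg_nonneg mult_neg_pos)
  have "\<bar>f (y + \<delta>) - secant f y t (y + \<delta>)\<bar> \<le> S"
  proof (rule secant_error_inside)
    show "continuous_on {y..y + t} f" using f y by (intro C_space_continuous_on) auto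
    show "\<bar>diff2 h f u\<bar> \<le> S" if "y \<le> u" "0 \<le> h" "u + 2 * h \<le> y + t" for u h
      unfolding S_def using that y fB by (intro abs_diff2_le power_mono) auto
  qed (use t zx in \<open>auto simp: \<delta>_def\<close>)
  then have "\<bar>f (y + \<delta>) - f y\<bar> \<le> \<bar>\<delta> / t * diff1 t f y\<bar> + S"
    unfolding secant_def diff1_def add_diff_cancel_left' by linarith
  moreover have "\<bar>f (y + \<delta>) - f y\<bar> = \<bar>f z - f x\<bar>"
    by (auto simp: y_def \<delta>_def min_def abs_if)
  moreover have "\<bar>\<delta> / t * diff1 t f y\<bar> = \<delta> / t * \<bar>diff1 t f y\<bar>"
    using t by (simp add: abs_mult \<delta>_def)
  ultimately have "weight p x * \<bar>f z - f x\<bar> \<le> weight p x * (\<delta> / t * \<bar>diff1 t f y\<bar> + S)"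
    using weight_pos[OF x, of p] by (intro mult_left_mono) auto
  also have "\<dots> = \<delta> / t * (weight p x * \<bar>diff1 t f y\<bar>) + weight p x * (1 + (x + t) ^ p) * modulus2 p f t"
    by (simp add: S_def algebra_simps)
  also have "\<dots> \<le> \<delta> / t * modulus1 p f t + (1 + 2 * (2 * K) ^ p) * modulus2 p f t"
  proof (intro add_mono mult_left_mono mult_right_mono weight_mult_power_le)
    have "weight p x * \<bar>diff1 t f y\<bar> \<le> weight p y * \<bar>diff1 t f y\<bar>"
      using y by (intro mult_right_mono weight_antimono) auto
    also have "\<dots> \<le> modulus1 p f t"
      using fB t y by (intro weight_mult_diff1_le_modulus1) auto
    finally show "weight p x * \<bar>diff1 t f y\<bar> \<le> modulus1 p f t" .
  qed (use t x K K0 modulus2_nonneg[OF fB, of t] in \<open>auto simp: \<delta>_def\<close>)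
  finally show ?thesis by (simp add: \<delta>_def)
qed

text \<open>
  The secant through \<open>z\<close> and \<open>z + t\<close> is reproduced in the mean, as \<open>z\<close> is the mean of
  \<open>k / B\<close>. The hypotheses on \<open>t\<close> say that \<open>t\<^sup>2\<close> dominates the order \<open>x / B\<close> of the variance,
  and that \<open>z\<close> and \<open>t\<close> are small enough for the weight at \<open>x\<close> to absorb \<open>(z + t) ^ p\<close>. The constant
  does not depend on \<open>A\<close> and \<open>B\<close>, because \<open>1 \<le> B\<close> gives \<open>1 + A * x \<le> B * (1 + x)\<close>.
\<close>

theorem jain_series_error:
  assumes \<beta>: "0 \<le> \<beta>" "\<beta> < 1" and K: "1 \<le> K"
  shows "\<exists>M\<ge>0. \<forall>A B x t f. f \<in> C_space p \<longrightarrow> 0 \<le> A \<longrightarrow> A \<le> B \<longrightarrow> 1 \<le> B \<longrightarrow> 0 \<le> x \<longrightarrow> 0 < t \<longrightarrow>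
    x / B \<le> t\<^sup>2 \<longrightarrow> A * x / (B * (1 - \<beta>)) + t \<le> K * (1 + x) \<longrightarrow>
    weight p x * \<bar>(\<Sum>k. jain_prob \<beta> k (A * x) * f (real k / B)) - f (A * x / (B * (1 - \<beta>)))\<bar>
      \<le> M * modulus2 p f t"
proof -
  obtain C0 where C0: "0 \<le> C0" "\<And>\<alpha>. 0 \<le> \<alpha> \<Longrightarrow>
      (\<Sum>k. (real k - \<alpha> / (1 - \<beta>))\<^sup>2 * jain_prob \<beta> k \<alpha>) \<le> C0 * \<alpha>"
    using jain_central_moment_le[OF \<beta>, of 0] by auto
  obtain Cv where Cv: "0 \<le> Cv" "\<And>\<alpha>. 0 \<le> \<alpha> \<Longrightarrow>
      (\<Sum>k. (real k - \<alpha> / (1 - \<beta>))\<^sup>2 * real k ^ p * jain_prob \<beta> k \<alpha>) \<le> Cv * \<alpha> * (1 + \<alpha>) ^ p"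
    using jain_central_moment_le[OF \<beta>, of p] by auto
  obtain Cm where Cm: "0 \<le> Cm" "\<And>\<alpha>. 0 \<le> \<alpha> \<Longrightarrow> jain_moment \<beta> p \<alpha> \<le> Cm * (1 + \<alpha>) ^ p"
    using jain_moment_le[OF \<beta>, of p] by auto
  define M where "M = 8 * ((1 + C0) * (1 + 2 * (2 * K) ^ p) + (Cm + Cv) * (1 + 2 * (2 * 1) ^ p))"
  have M0: "0 \<le> M" using C0 Cv Cm K by (auto simp: M_def intro!: add_nonneg_nonneg)
  have "weight p x * \<bar>(\<Sum>k. jain_prob \<beta> k (A * x) * f (real k / B)) - f (A * x / (B * (1 - \<beta>)))\<bar>
      \<le> M * modulus2 p f t"
    if f: "f \<in> C_space p" and A: "0 \<le> A" "A \<le> B" and B: "1 \<le> B" and x: "0 \<le> x" and t: "0 < t"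
      and xt: "x / B \<le> t\<^sup>2" and zt: "A * x / (B * (1 - \<beta>)) + t \<le> K * (1 + x)"
    for A B x t :: real and f :: "real \<Rightarrow> real"
  proof -
    define \<alpha> where "\<alpha> = A * x"
    define z where "z = A * x / (B * (1 - \<beta>))"
    define P where "P = (\<lambda>k. jain_prob \<beta> k \<alpha>)"
    define Y where "Y = (\<lambda>k. real k / B)"
    define \<omega> where "\<omega> = modulus2 p f t"
    define W where "W = 1 + (z + t) ^ p"
    have fB: "f \<in> B_space p" using f by (simp add: C_space_def)
    have \<alpha>: "0 \<le> \<alpha>" "\<alpha> \<le> B * x" using A x by (auto simp: \<alpha>_def intro: mult_right_mono)
    have z: "0 \<le> z" "z = \<alpha> / (1 - \<beta>) / B" using A B x \<beta> by (auto simp: z_def \<alpha>_def)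
    have P0: "0 \<le> P k" for k using \<beta> \<alpha> by (simp add: P_def jain_prob_nonneg)
    have \<omega>0: "0 \<le> \<omega>" using fB t by (simp add: \<omega>_def modulus2_nonneg)
    have W: "1 \<le> W" using z t by (simp add: W_def)
    \<comment> \<open>Rescaling the moments of \<open>k\<close> to those of \<open>Y\<close>.\<close>
    have sm: "summable (\<lambda>k. P k * Y k ^ r)" for r
    proof -
      have "summable (\<lambda>k. real k ^ r * jain_prob \<beta> k \<alpha> * (1 / B ^ r))"
        using \<beta> \<alpha> by (intro summable_mult2 summable_power_mult_jain_prob)
      then show ?thesis by (simp add: P_def Y_def power_divide mult_ac)
    qed
    have E: "(\<Sum>k. P k * Y k ^ r) = jain_moment \<beta> r \<alpha> / B ^ r" for r
    proof -
      have "(\<Sum>k. real k ^ r * jain_prob \<beta> k \<alpha> * (1 / B ^ r)) = jain_moment \<beta> r \<alpha> * (1 / B ^ r)"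
        unfolding jain_moment_def using \<beta> \<alpha> by (intro suminf_mult2[symmetric] summable_power_mult_jain_prob)
      then show ?thesis by (simp add: P_def Y_def power_divide mult_ac)
    qed
    have EP: "P sums 1"
      using sm[of 0] E[of 0] jain_moment_0[OF \<beta> \<alpha>(1)] by (simp add: sums_iff)
    have EY: "(\<lambda>k. P k * Y k) sums z"
      using sm[of 1] E[of 1] jain_moment_Suc[OF \<beta> \<alpha>(1), of 0] jain_moment_0[OF \<beta> \<alpha>(1)] jump_moment_0[OF \<beta>]
      by (simp add: sums_iff z(2))
    define V where "V = (\<lambda>r. \<Sum>k. (real k - \<alpha> / (1 - \<beta>))\<^sup>2 * real k ^ r * jain_prob \<beta> k \<alpha>)"
    have EV: "(\<lambda>k. P k * (((Y k - z) / t)\<^sup>2 * Y k ^ r)) sums (V r / (B\<^sup>2 * t\<^sup>2 * B ^ r))" for r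
    proof -
      have "(\<lambda>k. (real k - \<alpha> / (1 - \<beta>))\<^sup>2 * real k ^ r * jain_prob \<beta> k \<alpha> / (B\<^sup>2 * t\<^sup>2 * B ^ r)) sums
          (V r / (B\<^sup>2 * t\<^sup>2 * B ^ r))"
        unfolding V_def using jain_central_moment_eq[OF \<beta> \<alpha>(1), of r]
        by (intro sums_divide summable_sums) (simp add: sums_iff)
      moreover have "(real k - \<alpha> / (1 - \<beta>))\<^sup>2 * real k ^ r * jain_prob \<beta> k \<alpha> / (B\<^sup>2 * t\<^sup>2 * B ^ r) =
          P k * (((Y k - z) / t)\<^sup>2 * Y k ^ r)" for k
      proof -
        have "(Y k - z) / t = (real k - \<alpha> / (1 - \<beta>)) / (B * t)"
          unfolding Y_def z(2) by (simp add: diff_divide_distrib)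
        then show ?thesis by (simp add: P_def Y_def power_divide power_mult_distrib)
      qed
      ultimately show ?thesis by simp
    qed
    \<comment> \<open>Affine functions are reproduced at the mean \<open>z\<close>.\<close>
    define q where "q = (f (z + t) - f z) / t"
    have sec: "secant f z t y = f z + (y - z) * q" for y by (simp add: secant_def q_def)
    have Es: "(\<lambda>k. P k * secant f z t (Y k)) sums f z"
    proof -
      have "(\<lambda>k. f z * P k + (P k * Y k - z * P k) * q) sums (f z * 1 + (z - z * 1) * q)"
        by (intro sums_add sums_mult sums_mult2 sums_diff EP EY)
      then show ?thesis unfolding sec by (simp add: algebra_simps)
    qed
    have pw: "\<bar>f (Y k) - secant f z t (Y k)\<bar> \<le>
        8 * \<omega> * ((1 + ((Y k - z) / t)\<^sup>2) * (W + Y k ^ p))" for k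
    proof -
      have Yk: "0 \<le> Y k" using B by (simp add: Y_def)
      have "\<bar>f (Y k) - secant f z t (Y k)\<bar> \<le>
        8 * (1 + ((Y k - z) / t)\<^sup>2) * (\<omega> * (1 + (Y k ^ p + (z + t) ^ p)))"
      proof (rule secant_error[where A = 0 and B = "max (Y k) (z + t)"])
        show "continuous_on {0..max (Y k) (z + t)} f" using f by (intro C_space_continuous_on) auto
        show "\<bar>diff2 h f u\<bar> \<le> \<omega> * (1 + (Y k ^ p + (z + t) ^ p))"
          if "0 \<le> u" "0 \<le> h" "h \<le> t" "u + 2 * h \<le> max (Y k) (z + t)" for u h
          unfolding \<omega>_def
        proof (rule abs_diff2_le[OF fB that(2,3,1)])
          have "u ^ p \<le> max (Y k) (z + t) ^ p" using that by (intro power_mono) auto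
          also have "\<dots> \<le> Y k ^ p + (z + t) ^ p" using Yk z t by (auto simp: max_def)
          finally show "u ^ p \<le> Y k ^ p + (z + t) ^ p" .
        qed
      qed (use t z Yk in auto)
      also have "\<dots> = 8 * \<omega> * ((1 + ((Y k - z) / t)\<^sup>2) * (W + Y k ^ p))" by (simp add: W_def mult_ac add_ac)
      finally show ?thesis .
    qed
    have Eb: "(\<lambda>k. 8 * \<omega> * (P k * ((1 + ((Y k - z) / t)\<^sup>2) * (W + Y k ^ p)))) sums
        (8 * \<omega> * (W * 1 + W * (V 0 / (B\<^sup>2 * t\<^sup>2 * B ^ 0)) + jain_moment \<beta> p \<alpha> / B ^ p + V p / (B\<^sup>2 * t\<^sup>2 * B ^ p)))"
    proof -
      have "(\<lambda>k. W * P k + W * (P k * (((Y k - z) / t)\<^sup>2 * Y k ^ 0)) + P k * Y k ^ p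
            + P k * (((Y k - z) / t)\<^sup>2 * Y k ^ p)) sums
        (W * 1 + W * (V 0 / (B\<^sup>2 * t\<^sup>2 * B ^ 0)) + jain_moment \<beta> p \<alpha> / B ^ p + V p / (B\<^sup>2 * t\<^sup>2 * B ^ p))"
        using sm[of p] E[of p] by (intro sums_add sums_mult EP EV) (simp add: sums_iff)
      then have "(\<lambda>k. P k * ((1 + ((Y k - z) / t)\<^sup>2) * (W + Y k ^ p))) sums
        (W * 1 + W * (V 0 / (B\<^sup>2 * t\<^sup>2 * B ^ 0)) + jain_moment \<beta> p \<alpha> / B ^ p + V p / (B\<^sup>2 * t\<^sup>2 * B ^ p))"
        by (simp add: algebra_simps)
      then show ?thesis by (rule sums_mult)
    qed
    have le: "\<bar>P k * f (Y k) - P k * secant f z t (Y k)\<bar> \<le> 8 * \<omega> * (P k * ((1 + ((Y k - z) / t)\<^sup>2) * (W + Y k ^ p)))" for k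
    proof -
      have "\<bar>P k * f (Y k) - P k * secant f z t (Y k)\<bar> = P k * \<bar>f (Y k) - secant f z t (Y k)\<bar>"
        using P0[of k] by (simp add: right_diff_distrib[symmetric] abs_mult)
      also have "\<dots> \<le> P k * (8 * \<omega> * ((1 + ((Y k - z) / t)\<^sup>2) * (W + Y k ^ p)))"
        using P0 pw by (intro mult_left_mono) auto
      finally show ?thesis by (simp add: mult_ac)
    qed
    have sd: "summable (\<lambda>k. \<bar>P k * f (Y k) - P k * secant f z t (Y k)\<bar>)"
      by (rule summable_comparison_test'[OF sums_summable[OF Eb]]) (use le in auto)
    have "(\<Sum>k. P k * f (Y k)) - f z = (\<Sum>k. P k * f (Y k) - P k * secant f z t (Y k))"
    proof -
      have "(\<lambda>k. (P k * f (Y k) - P k * secant f z t (Y k)) + P k * secant f z t (Y k)) sums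
          ((\<Sum>k. P k * f (Y k) - P k * secant f z t (Y k)) + f z)"
        by (intro sums_add Es summable_sums summable_rabs_cancel[OF sd])
      then show ?thesis by (simp add: sums_iff)
    qed
    also have "\<bar>\<dots>\<bar> \<le> (\<Sum>k. \<bar>P k * f (Y k) - P k * secant f z t (Y k)\<bar>)"
      by (rule summable_rabs[OF sd])
    also have "\<dots> \<le> 8 * \<omega> * (W * 1 + W * (V 0 / (B\<^sup>2 * t\<^sup>2 * B ^ 0)) + jain_moment \<beta> p \<alpha> / B ^ p + V p / (B\<^sup>2 * t\<^sup>2 * B ^ p))"
      using suminf_le[OF le sd sums_summable[OF Eb]] Eb by (simp add: sums_iff)
    also have "\<dots> \<le> 8 * \<omega> * (W * 1 + W * C0 + Cm * (1 + x) ^ p + Cv * (1 + x) ^ p)"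
    proof -
      have \<alpha>B: "\<alpha> \<le> B\<^sup>2 * t\<^sup>2"
      proof -
        have "B * x = B\<^sup>2 * (x / B)" using B by (simp add: power2_eq_square)
        also have "\<dots> \<le> B\<^sup>2 * t\<^sup>2" by (intro mult_left_mono xt) auto
        finally show ?thesis using \<alpha> by simp
      qed
      have pow: "(1 + \<alpha>) ^ p \<le> B ^ p * (1 + x) ^ p"
      proof -
        have "1 + \<alpha> \<le> B * (1 + x)" using \<alpha> B by (simp add: algebra_simps)
        then show ?thesis using \<alpha> power_mono[of "1 + \<alpha>" "B * (1 + x)" p] by (simp add: power_mult_distrib)
      qed
      have "V 0 \<le> C0 * (B\<^sup>2 * t\<^sup>2 * B ^ 0)"
        using C0(2)[OF \<alpha>(1)] mult_left_mono[OF \<alpha>B C0(1)] by (simp add: V_def)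
      moreover have "jain_moment \<beta> p \<alpha> \<le> Cm * (1 + x) ^ p * B ^ p"
        using Cm(2)[OF \<alpha>(1)] mult_left_mono[OF pow Cm(1)] by (simp add: mult_ac)
      moreover have "V p \<le> Cv * (1 + x) ^ p * (B\<^sup>2 * t\<^sup>2 * B ^ p)"
      proof -
        have "V p \<le> Cv * (\<alpha> * (1 + \<alpha>) ^ p)" using Cv(2)[OF \<alpha>(1)] by (simp add: V_def mult_ac)
        also have "\<dots> \<le> Cv * (B\<^sup>2 * t\<^sup>2 * (B ^ p * (1 + x) ^ p))"
          using \<alpha> Cv by (intro mult_left_mono mult_mono \<alpha>B pow) auto
        finally show ?thesis by (simp add: mult_ac)
      qed
      moreover have "0 < B\<^sup>2 * t\<^sup>2 * B ^ r" "0 < B ^ r" for r using B t by auto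
      ultimately have "V 0 / (B\<^sup>2 * t\<^sup>2 * B ^ 0) \<le> C0" "jain_moment \<beta> p \<alpha> / B ^ p \<le> Cm * (1 + x) ^ p"
        "V p / (B\<^sup>2 * t\<^sup>2 * B ^ p) \<le> Cv * (1 + x) ^ p"
        by (simp_all only: pos_divide_le_eq)
      then show ?thesis using W \<omega>0 by (intro mult_left_mono add_mono) auto
    qed
    finally have "\<bar>(\<Sum>k. P k * f (Y k)) - f z\<bar> \<le> 8 * \<omega> * (W * 1 + W * C0 + Cm * (1 + x) ^ p + Cv * (1 + x) ^ p)" .
    then have "weight p x * \<bar>(\<Sum>k. P k * f (Y k)) - f z\<bar> \<le>
        weight p x * (8 * \<omega> * (W * 1 + W * C0 + Cm * (1 + x) ^ p + Cv * (1 + x) ^ p))"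
      using weight_pos[OF x, of p] by (intro mult_left_mono) auto
    also have "\<dots> = 8 * ((1 + C0) * (weight p x * W) + (Cm + Cv) * (weight p x * (1 + x) ^ p)) * \<omega>"
      by (simp add: algebra_simps)
    also have "\<dots> \<le> M * \<omega>" unfolding M_def
    proof (intro mult_right_mono mult_left_mono add_mono)
      show "weight p x * W \<le> 1 + 2 * (2 * K) ^ p"
        unfolding W_def using x K z t zt by (intro weight_mult_power_le) (auto simp: z_def)
      have "weight p x * (1 + x) ^ p \<le> weight p x * (1 + (1 + x) ^ p)"
        using weight_pos[OF x, of p] by (intro mult_left_mono) auto
      also have "\<dots> \<le> 1 + 2 * (2 * 1) ^ p" using x by (intro weight_mult_power_le) auto
      finally show "weight p x * (1 + x) ^ p \<le> 1 + 2 * (2 * 1) ^ p" .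
    qed (use C0 Cm Cv \<omega>0 in auto)
    finally show ?thesis by (simp add: P_def Y_def \<omega>_def z_def \<alpha>_def)
  qed
  with M0 show ?thesis by blast
qed

section \<open>The estimate\<close>

text \<open>
  The quotients \<open>a n / b n\<close> increase to the limit \<open>1\<close>.
\<close>

lemma admissible_bounds:
  assumes "admissible a b" "1 \<le> n"
  shows "1 \<le> a n" "1 \<le> b n" "a n \<le> b n"
proof -
  have ab: "\<And>n. 1 \<le> n \<Longrightarrow> 1 \<le> a n" "\<And>n. 1 \<le> n \<Longrightarrow> 1 \<le> b n"
    and mono: "mono_on {1..} (\<lambda>n. a n / b n)"
    and o: "(\<lambda>n. a n / b n - 1) \<in> o(\<lambda>n. 1 / b n)"
    using assms(1) by (auto simp: admissible_def)
  show "1 \<le> a n" "1 \<le> b n" using ab assms(2) by auto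
  have "a n / b n \<le> 1 + e" if "0 < e" for e
  proof -
    obtain m where m: "n \<le> m" "norm (a m / b m - 1) \<le> e * norm (1 / b m)"
      using landau_o.smallD[OF o \<open>0 < e\<close>] eventually_happens'[OF _ eventually_conj[OF _ eventually_ge_at_top[of n]]]
      by (metis (no_types, lifting) eventually_sequentially linorder_le_cases)
    have "norm (1 / b m) \<le> 1" using ab(2)[of m] m(1) assms(2) by simp
    then have "norm (a m / b m - 1) \<le> e * 1" using m(2) that by (meson less_imp_le mult_left_mono order_trans)
    moreover have "a n / b n \<le> a m / b m" using mono_onD[OF mono, of n m] m(1) assms(2) by simp
    ultimately show ?thesis by simp
  qed
  then have "a n / b n \<le> 1" by (rule field_le_epsilon)
  then show "a n \<le> b n" using ab(2)[OF assms(2)] by (simp add: divide_le_eq)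
qed

theorem theorem3:
  fixes \<beta> b1 :: real and p :: nat
  assumes "0 \<le> \<beta>" and "\<beta> < 1"
  shows "(\<exists>M5>0. \<forall>a b. admissible a b \<and> b 1 = b1 \<longrightarrow>
            (\<forall>f\<in>C_space p. \<forall>x>0. \<forall>n\<ge>1.
               weight p x * \<bar>jain_op \<beta> a b n f x - f x\<bar>
                 \<le> \<bar>a n / (b n * (1 - \<beta>)) - 1\<bar> * x * xi \<beta> a b n x powr (- 1 / 2)
                      * modulus1 p f (sqrt (xi \<beta> a b n x))
                   + M5 * modulus2 p f (sqrt (xi \<beta> a b n x))))
         \<and> (\<forall>a b. admissible a b \<longrightarrow>
              (\<forall>f\<in>C_space p. \<forall>n\<ge>1. jain_op \<beta> a b n f 0 = f 0))"
proof -
  define \<kappa> where "\<kappa> = 1 / (1 - \<beta>)"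
  \<comment> \<open>Chosen so that \<open>z + t \<le> K * (1 + x)\<close> and \<open>x + t \<le> K * (1 + x)\<close> below.\<close>
  define K where "K = 2 * \<kappa>\<^sup>2"
  have \<kappa>: "1 \<le> \<kappa>" using assms by (simp add: \<kappa>_def)
  then have \<kappa>2: "\<kappa> \<le> \<kappa>\<^sup>2" "1 \<le> \<kappa>\<^sup>2" by (simp_all add: power2_eq_square mult_ge1_I)
  have K1: "1 \<le> K" using \<kappa>2 by (simp add: K_def)
  obtain M where M0: "0 \<le> M" and M: "\<forall>A B x t f. f \<in> C_space p \<longrightarrow> 0 \<le> A \<longrightarrow> A \<le> B \<longrightarrow>
    1 \<le> B \<longrightarrow> 0 \<le> x \<longrightarrow> 0 < t \<longrightarrow> x / B \<le> t\<^sup>2 \<longrightarrow> A * x / (B * (1 - \<beta>)) + t \<le> K * (1 + x) \<longrightarrow>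
    weight p x * \<bar>(\<Sum>k. jain_prob \<beta> k (A * x) * f (real k / B)) - f (A * x / (B * (1 - \<beta>)))\<bar>
      \<le> M * modulus2 p f t"
    using jain_series_error[OF assms K1, of p] by blast
  define L where "L = 1 + 2 * (2 * K) ^ p"
  have L: "0 < L" using K1 by (simp add: L_def add_pos_nonneg)
  have est: "weight p x * \<bar>jain_op \<beta> a b n f x - f x\<bar>
      \<le> \<bar>a n / (b n * (1 - \<beta>)) - 1\<bar> * x * xi \<beta> a b n x powr (- 1 / 2)
           * modulus1 p f (sqrt (xi \<beta> a b n x))
         + (M + L) * modulus2 p f (sqrt (xi \<beta> a b n x))"
    if ad: "admissible a b" and f: "f \<in> C_space p" and x: "0 < x" and n: "1 \<le> n" for a b f x n
  proof -
    define c where "c = a n / (b n * (1 - \<beta>))"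
    define z where "z = a n * x / (b n * (1 - \<beta>))"
    define t where "t = sqrt (xi \<beta> a b n x)"
    have ab: "1 \<le> a n" "1 \<le> b n" "a n \<le> b n" using admissible_bounds[OF ad n] .
    have xi: "xi \<beta> a b n x = (x * (c - 1))\<^sup>2 + \<kappa> ^ 3 * (x / b n)"
      by (simp add: xi_def c_def \<kappa>_def power_mult_distrib power_divide)
    have xb: "0 < x / b n" "x / b n \<le> x" using x ab by (auto simp: divide_le_eq)
    have \<kappa>3: "1 \<le> \<kappa> ^ 3" using \<kappa> by (rule one_le_power)
    have \<kappa>xb: "0 < \<kappa> ^ 3 * (x / b n)" using xb \<kappa> by (intro mult_pos_pos) auto
    have xi_pos: "0 < xi \<beta> a b n x" unfolding xi using \<kappa>xb by (intro add_nonneg_pos) auto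
    have t: "0 < t" "t\<^sup>2 = xi \<beta> a b n x" using xi_pos by (auto simp: t_def)
    have z: "z = c * x" by (simp add: z_def c_def)
    have c: "0 \<le> c" "c \<le> \<kappa>"
    proof -
      have "a n / b n \<le> 1" using ab by simp
      then have "a n / b n * \<kappa> \<le> 1 * \<kappa>" using \<kappa> by (intro mult_right_mono) auto
      then show "c \<le> \<kappa>" by (simp add: c_def \<kappa>_def)
      show "0 \<le> c" using ab assms by (simp add: c_def)
    qed
    have zx: "z - x = x * (c - 1)" by (simp add: z algebra_simps)
    have "\<bar>z - x\<bar> = sqrt ((x * (c - 1))\<^sup>2)" by (simp add: zx)
    also have "\<dots> \<le> t" unfolding t_def xi using \<kappa>xb by (intro real_sqrt_le_mono) simp
    finally have zx_le: "\<bar>z - x\<bar> \<le> t" .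
    have xbt: "x / b n \<le> t\<^sup>2"
    proof -
      have "1 * (x / b n) \<le> \<kappa> ^ 3 * (x / b n)" using \<kappa>3 xb by (intro mult_right_mono) auto
      then show ?thesis unfolding t xi by (simp add: add_increasing)
    qed
    have "t \<le> \<kappa>\<^sup>2 * (1 + x)"
    proof (rule power2_le_imp_le)
      have "(x * (c - 1))\<^sup>2 \<le> (x * \<kappa>)\<^sup>2"
        using x c \<kappa> by (intro abs_le_square_iff[THEN iffD1]) (auto simp: abs_mult abs_le_iff)
      also have "\<dots> = \<kappa> ^ 2 * x\<^sup>2" by (simp add: power_mult_distrib mult_ac)
      also have "\<dots> \<le> \<kappa> ^ 4 * x\<^sup>2" using \<kappa> by (intro mult_right_mono power_increasing) auto
      finally have 1: "(x * (c - 1))\<^sup>2 \<le> \<kappa> ^ 4 * x\<^sup>2" .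
      have 2: "\<kappa> ^ 3 * (x / b n) \<le> \<kappa> ^ 4 * x"
        using \<kappa> xb x by (intro mult_mono power_increasing) auto
      have "t\<^sup>2 \<le> \<kappa> ^ 4 * x\<^sup>2 + \<kappa> ^ 4 * x" unfolding t xi using 1 2 by simp
      also have "\<dots> = \<kappa> ^ 4 * (x\<^sup>2 + x)" by (simp add: algebra_simps)
      also have "\<dots> \<le> \<kappa> ^ 4 * (1 + x)\<^sup>2"
        using \<kappa> x by (intro mult_left_mono) (auto simp: power2_eq_square algebra_simps)
      also have "\<dots> = (\<kappa>\<^sup>2 * (1 + x))\<^sup>2" by (simp add: power_mult_distrib)
      finally show "t\<^sup>2 \<le> (\<kappa>\<^sup>2 * (1 + x))\<^sup>2" .
    qed (use x in auto)
    moreover have "z \<le> \<kappa>\<^sup>2 * (1 + x)" "x \<le> \<kappa>\<^sup>2 * (1 + x)"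
      unfolding z using c \<kappa>2 x mult_mono[of c "\<kappa>\<^sup>2" x "1 + x"] mult_mono[of 1 "\<kappa>\<^sup>2" x "1 + x"] by auto
    ultimately have zt: "z + t \<le> K * (1 + x)" "x + t \<le> K * (1 + x)" by (auto simp: K_def)
    have "weight p x * \<bar>jain_op \<beta> a b n f x - f x\<bar> \<le>
        weight p x * (\<bar>jain_op \<beta> a b n f x - f z\<bar> + \<bar>f z - f x\<bar>)"
      using weight_pos[of x p] x by (intro mult_left_mono) auto
    also have "\<dots> \<le> M * modulus2 p f t + (\<bar>z - x\<bar> / t * modulus1 p f t + L * modulus2 p f t)"
      unfolding distrib_left
    proof (intro add_mono)
      show "weight p x * \<bar>jain_op \<beta> a b n f x - f z\<bar> \<le> M * modulus2 p f t"
        unfolding jain_op_def z_def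
        by (rule M[rule_format, OF f]) (use ab x t xbt zt in \<open>auto simp: z_def\<close>)
      show "weight p x * \<bar>f z - f x\<bar> \<le> \<bar>z - x\<bar> / t * modulus1 p f t + L * modulus2 p f t"
        unfolding L_def using x c t zt zx_le by (intro weighted_shift_le f) (auto simp: z)
    qed
    also have "\<bar>z - x\<bar> / t = \<bar>c - 1\<bar> * x * xi \<beta> a b n x powr (- 1 / 2)"
      using x xi_pos by (simp add: zx abs_mult t_def powr_minus_divide powr_half_sqrt)
    finally show ?thesis by (simp add: c_def t_def algebra_simps)
  qed
  have zero: "jain_op \<beta> a b n f 0 = f 0" for a b f n
    using suminf_finite[of "{0}" "\<lambda>k. jain_prob \<beta> k 0 * f (real k / b n)"]
    by (simp add: jain_op_def jain_prob_at_0)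
  have "0 < M + L" using M0 L by simp
  then show ?thesis using est zero by blast
qed

end
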